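(* Let $\mathfrak g=W$ or $W_{\geq-1}$ or $W_{\geq1}$. Then $\mathrm{S}(\mathfrak g)$ has no nonzero prime Poisson ideals of finite height.
   Context: $\Bbbk$ is an uncountable algebraically closed field of characteristic $0$; $\partial=d/dt$. $W=\Bbbk[t,t^{-1}]\partial$ with $[f\partial,g\partial]=(fg'-f'g)\partial$; $W_{\geq-1}=\Bbbk[t]\partial$ and $W_{\geq1}=t^2\Bbbk[t]\partial$ are subalgebras. $\mathrm{S}(\mathfrak g)$ is a Poisson algebra with bracket extending $\{u,v\}=[u,v]$; a Poisson ideal is an ideal $I$ with $\{I,\mathrm{S}(\mathfrak g)\}\subseteq I$. The height of a prime Poisson ideal $Q$ is the supremum of lengths $n$ of strictly increasing chains $Q_0\subsetneq Q_1\subsetneq\dots\subsetneq Q_n=Q$ of prime Poisson ideals. *)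

theory Defs
  imports
    "HOL-Library.Poly_Mapping"
    "HOL-Library.Extended_Nat"
    "HOL-Library.Countable_Set"
    "HOL-Computational_Algebra.Polynomial"
    "HOL-Algebra.Ideal"
begin

section \<open>The Witt algebra\<close>

text \<open>
  The type \<^typ>\<open>int \<Rightarrow>\<^sub>0 'k\<close> with its convolution product is the ring of Laurent
  polynomials over \<open>'k\<close>, \<open>Poly_Mapping.single n c\<close> being $c\,t^n$.  The Laurent polynomial
  \<open>f\<close> also stands for the vector field $f\,\partial$.
\<close>

type_synonym 'k laurent = "int \<Rightarrow>\<^sub>0 'k"

definition laurent_deriv :: "'k::comm_ring_1 laurent \<Rightarrow> 'k laurent" where
  "laurent_deriv f =
     (\<Sum>n\<in>Poly_Mapping.keys f. Poly_Mapping.single (n - 1) (of_int n * Poly_Mapping.lookup f n))"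

definition witt_bracket :: "'k::comm_ring_1 laurent \<Rightarrow> 'k laurent \<Rightarrow> 'k laurent" where
  "witt_bracket f g = f * laurent_deriv g - laurent_deriv f * g"

definition Witt :: "'k::comm_ring_1 laurent set" where
  "Witt = UNIV"

definition Witt_ge_m1 :: "'k::comm_ring_1 laurent set" where
  "Witt_ge_m1 = {f. Poly_Mapping.keys f \<subseteq> {0..}}"

definition Witt_ge_1 :: "'k::comm_ring_1 laurent set" where
  "Witt_ge_1 = {f. Poly_Mapping.keys f \<subseteq> {2..}}"


section \<open>The symmetric algebra and its Poisson bracket\<close>

text \<open>
  $S(W)$ is the polynomial ring over \<open>'k\<close> in the basis vectors $t^n\partial$ ($n \in \mathbb{Z}$)
  of $W$.  Beware of the index shift: variable number \<open>n\<close> is $t^n\partial$, which is often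
  written $e_{n-1}$.
\<close>

type_synonym 'k sym = "(int \<Rightarrow>\<^sub>0 nat) \<Rightarrow>\<^sub>0 'k"

definition sym_const :: "'k::comm_ring_1 \<Rightarrow> 'k sym" where
  "sym_const c = Poly_Mapping.single 0 c"

definition sym_emb :: "'k::comm_ring_1 laurent \<Rightarrow> 'k sym" where
  "sym_emb f =
     (\<Sum>n\<in>Poly_Mapping.keys f.
        Poly_Mapping.single (Poly_Mapping.single n 1) (Poly_Mapping.lookup f n))"

text \<open>
  For a subspace \<open>g\<close> of $W$ the algebra $S(g)$ is the subalgebra of $S(W)$ generated by \<open>g\<close>
  (see \<open>Sym_universal\<close> and \<open>Sym_universal_unique\<close> below).
\<close>

inductive_set Sym :: "'k::comm_ring_1 laurent set \<Rightarrow> 'k sym set"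
  for g :: "'k laurent set" where
  const: "sym_const c \<in> Sym g"
| emb: "u \<in> g \<Longrightarrow> sym_emb u \<in> Sym g"
| add: "p \<in> Sym g \<Longrightarrow> q \<in> Sym g \<Longrightarrow> p + q \<in> Sym g"
| mult: "p \<in> Sym g \<Longrightarrow> q \<in> Sym g \<Longrightarrow> p * q \<in> Sym g"

definition sym_vars :: "'k::comm_ring_1 sym \<Rightarrow> int set" where
  "sym_vars p = (\<Union>m\<in>Poly_Mapping.keys p. Poly_Mapping.keys m)"

definition sym_pderiv :: "int \<Rightarrow> 'k::comm_ring_1 sym \<Rightarrow> 'k sym" where
  "sym_pderiv i p =
     (\<Sum>m\<in>Poly_Mapping.keys p.
        Poly_Mapping.single (m - Poly_Mapping.single i 1)
          (of_nat (Poly_Mapping.lookup m i) * Poly_Mapping.lookup p m))"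

text \<open>
  The lemmas \<open>poisson_emb\<close>, \<open>poisson_const\<close>, \<open>poisson_add_left\<close>, \<open>poisson_mult_left\<close>
  and \<open>poisson_antisym\<close> below show that this is the biderivation extending the Lie bracket;
  by \<open>Sym_poisson_closed\<close> it restricts to $S(g)$ for the three \<open>g\<close> above.
\<close>

definition poisson :: "'k::comm_ring_1 sym \<Rightarrow> 'k sym \<Rightarrow> 'k sym" where
  "poisson p q =
     (\<Sum>i\<in>sym_vars p. \<Sum>j\<in>sym_vars q.
        sym_pderiv i p * sym_pderiv j q *
        sym_emb (witt_bracket (Poly_Mapping.single i 1) (Poly_Mapping.single j 1)))"


section \<open>Prime Poisson ideals and their height\<close>

definition Sym_ring :: "'k::comm_ring_1 laurent set \<Rightarrow> 'k sym ring" where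
  "Sym_ring g = \<lparr>carrier = Sym g, mult = (*), one = 1, zero = 0, add = (+)\<rparr>"

definition prime_poisson_ideal :: "'k::comm_ring_1 laurent set \<Rightarrow> 'k sym set \<Rightarrow> bool" where
  "prime_poisson_ideal g I \<longleftrightarrow>
     primeideal I (Sym_ring g) \<and> (\<forall>p\<in>I. \<forall>q\<in>Sym g. poisson p q \<in> I)"

definition poisson_height :: "'k::comm_ring_1 laurent set \<Rightarrow> 'k sym set \<Rightarrow> enat" where
  "poisson_height g Q =
     Sup {enat n | n. \<exists>c. (\<forall>i\<le>n. prime_poisson_ideal g (c i)) \<and>
                           (\<forall>i<n. c i \<subset> c (Suc i)) \<and> c n = Q}"


section \<open>Basic properties\<close>

abbreviation (input) "lk \<equiv> Poly_Mapping.lookup"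
abbreviation (input) "ky \<equiv> Poly_Mapping.keys"
abbreviation (input) "sg \<equiv> Poly_Mapping.single"

lemma pm_expand:
  fixes p :: "'a \<Rightarrow>\<^sub>0 'b::comm_monoid_add"
  shows "p = (\<Sum>m\<in>ky p. sg m (lk p m))"
proof (rule poly_mapping_eqI)
  fix k show "lk p k = lk (\<Sum>m\<in>ky p. sg m (lk p m)) k"
    by (simp add: lookup_sum lookup_single when_def in_keys_iff)
qed

lemma pm_induct [case_names single add]:
  fixes p :: "'a \<Rightarrow>\<^sub>0 'b::comm_monoid_add"
  assumes s: "\<And>m c. P (sg m c)" and a: "\<And>p q. P p \<Longrightarrow> P q \<Longrightarrow> P (p + q)"
  shows "P p"
proof -
  have z: "P 0" using s[of undefined 0] by simp
  have "P (\<Sum>m\<in>A. sg m (lk p m))" if "finite A" for A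
    using that by (induction) (auto simp: z s a)
  from this[OF finite_keys[of p]] show ?thesis by (simp only: pm_expand[symmetric])
qed

lemma sum_keys_add:
  fixes F :: "'a \<Rightarrow> 'b::comm_monoid_add \<Rightarrow> 'c::comm_monoid_add"
  assumes "\<And>k. F k 0 = 0" "\<And>k x y. F k (x + y) = F k x + F k y"
  shows "(\<Sum>k\<in>ky (p + q). F k (lk (p + q) k)) =
         (\<Sum>k\<in>ky p. F k (lk p k)) + (\<Sum>k\<in>ky q. F k (lk q k))"
  using setsum_keys_plus_distrib[of F p q] assms by blast

lemma laurent_deriv_single [simp]: "laurent_deriv (sg n c) = sg (n - 1) (of_int n * c)"
  by (cases "c = 0") (simp_all add: laurent_deriv_def)

lemma laurent_deriv_add: "laurent_deriv (f + g) = laurent_deriv f + laurent_deriv g"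
  unfolding laurent_deriv_def
  by (rule sum_keys_add) (simp_all add: single_add algebra_simps)

lemma witt_bracket_add_left: "witt_bracket (f + g) h = witt_bracket f h + witt_bracket g h"
  by (simp add: witt_bracket_def laurent_deriv_add algebra_simps)

lemma witt_bracket_antisym: "witt_bracket f g = - witt_bracket g f"
  by (simp add: witt_bracket_def algebra_simps)

lemma witt_bracket_add_right: "witt_bracket h (f + g) = witt_bracket h f + witt_bracket h g"
  by (simp add: witt_bracket_def laurent_deriv_add algebra_simps)

lemma witt_bracket_single:
  "witt_bracket (sg i a) (sg j b) = sg (i + j - 1) (of_int (j - i) * a * b)"
proof -
  have e: "i + (j - 1) = i + j - 1" "i - 1 + j = i + j - 1" by simp_all
  show ?thesis
    by (simp add: witt_bracket_def mult_single e single_diff[symmetric] algebra_simps)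
qed

lemma sym_emb_single [simp]: "sym_emb (sg n c) = sg (sg n 1) c"
  by (cases "c = 0") (simp_all add: sym_emb_def)

lemma sym_emb_add: "sym_emb (f + g) = sym_emb f + sym_emb g"
  unfolding sym_emb_def by (rule sum_keys_add) (simp_all add: single_add)

lemma sym_emb_scale: "sym_emb (sg 0 c * f) = sym_const c * sym_emb f"
  by (induction f rule: pm_induct)
     (simp_all add: sym_emb_add sym_const_def mult_single distrib_left)

lemma sym_emb_zero [simp]: "sym_emb 0 = 0"
  by (simp add: sym_emb_def)

lemma sym_pderiv_single [simp]:
  "sym_pderiv i (sg m c) = sg (m - sg i 1) (of_nat (lk m i) * c)"
  by (cases "c = 0") (simp_all add: sym_pderiv_def)

lemma sym_pderiv_add: "sym_pderiv i (p + q) = sym_pderiv i p + sym_pderiv i q"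
  unfolding sym_pderiv_def by (rule sum_keys_add) (simp_all add: single_add algebra_simps)

lemma sym_pderiv_mult: "sym_pderiv i (p * q) = sym_pderiv i p * q + p * sym_pderiv i q"
proof (induction p rule: pm_induct)
  case (single m a)
  show ?case
  proof (induction q rule: pm_induct)
    case (single n b)
    have shift: "(m - sg i 1) + n = m + n - sg i 1" if "lk m i > 0" for m n :: "int \<Rightarrow>\<^sub>0 nat"
      using that by (intro poly_mapping_eqI)
        (auto simp: lookup_add lookup_minus lookup_single when_def)
    have 1: "sg ((m - sg i 1) + n) (of_nat (lk m i) * a * b)
        = sg (m + n - sg i 1) (of_nat (lk m i) * a * b)"
      using shift[of m n] by (cases "lk m i = 0") simp_all
    have 2: "sg (m + (n - sg i 1)) (a * (of_nat (lk n i) * b))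
        = sg (m + n - sg i 1) (a * (of_nat (lk n i) * b))"
      using shift[of n m] by (cases "lk n i = 0") (simp_all add: add.commute)
    have "sym_pderiv i (sg m a * sg n b) =
        sg (m + n - sg i 1) (of_nat (lk m i) * a * b + a * (of_nat (lk n i) * b))"
      by (simp only: mult_single sym_pderiv_single lookup_add of_nat_add)
         (simp add: algebra_simps)
    also have "\<dots> = sym_pderiv i (sg m a) * sg n b + sg m a * sym_pderiv i (sg n b)"
      by (simp only: single_add 1[symmetric] 2[symmetric] mult_single sym_pderiv_single)
    finally show ?case .
  qed (simp add: sym_pderiv_add algebra_simps)
qed (simp add: sym_pderiv_add algebra_simps)

lemma sym_pderiv_notin: "i \<notin> sym_vars p \<Longrightarrow> sym_pderiv i p = 0"
  unfolding sym_pderiv_def sym_vars_def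
  by (intro sum.neutral) (auto simp: in_keys_iff)

lemma sym_pderiv_emb: "sym_pderiv i (sym_emb u) = sym_const (lk u i)"
  by (induction u rule: pm_induct)
     (auto simp: sym_const_def sym_emb_add sym_pderiv_add lookup_add single_add
       lookup_single when_def)

lemma finite_sym_vars [simp]: "finite (sym_vars p)"
  by (simp add: sym_vars_def)

lemma poisson_eq:
  assumes "finite A" "sym_vars p \<subseteq> A" "finite B" "sym_vars q \<subseteq> B"
  shows "poisson p q = (\<Sum>i\<in>A. \<Sum>j\<in>B. sym_pderiv i p * sym_pderiv j q *
           sym_emb (witt_bracket (sg i 1) (sg j 1)))"
proof -
  let ?f = "\<lambda>i j. sym_pderiv i p * sym_pderiv j q * sym_emb (witt_bracket (sg i 1) (sg j 1))"
  have "poisson p q = (\<Sum>i\<in>sym_vars p. \<Sum>j\<in>B. ?f i j)"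
    unfolding poisson_def using assms
    by (intro sum.cong refl sum.mono_neutral_left) (auto simp: sym_pderiv_notin)
  also have "\<dots> = (\<Sum>i\<in>A. \<Sum>j\<in>B. ?f i j)"
    using assms by (intro sum.mono_neutral_left) (auto simp: sym_pderiv_notin)
  finally show ?thesis .
qed

lemma poisson_antisym: "poisson p q = - poisson q p"
proof -
  have "poisson p q = (\<Sum>i\<in>sym_vars p. \<Sum>j\<in>sym_vars q. - (sym_pderiv j q * sym_pderiv i p *
           sym_emb (witt_bracket (sg j 1) (sg i 1))))"
    unfolding poisson_def
  proof (intro sum.cong refl)
    fix i j
    have "sym_emb (witt_bracket (sg i 1) (sg j 1)) = - sym_emb (witt_bracket (sg j 1) (sg i (1::'a)))"
      by (simp add: witt_bracket_single single_uminus[symmetric] algebra_simps)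
    then show "sym_pderiv i p * sym_pderiv j q * sym_emb (witt_bracket (sg i 1) (sg j 1)) =
       - (sym_pderiv j q * sym_pderiv i p * sym_emb (witt_bracket (sg j 1) (sg i 1)))"
      by (simp add: mult.commute)
  qed
  also have "\<dots> = - poisson q p"
    unfolding poisson_def sum_negf
    by (subst sum.swap) simp
  finally show ?thesis .
qed

lemma poisson_add_left: "poisson (p + q) r = poisson p r + poisson q r"
proof -
  define E where
    "E i j = sym_emb (witt_bracket (sg i 1) (sg j (1::'a)))" for i j
  define A where "A = sym_vars (p + q) \<union> sym_vars p \<union> sym_vars q"
  have e: "poisson x r = (\<Sum>i\<in>A. \<Sum>j\<in>sym_vars r. sym_pderiv i x * sym_pderiv j r * E i j)"
    if "sym_vars x \<subseteq> A" for x
    unfolding E_def using that by (intro poisson_eq) (auto simp: A_def)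
  have s: "sym_vars (p + q) \<subseteq> A" "sym_vars p \<subseteq> A" "sym_vars q \<subseteq> A"
    by (auto simp: A_def)
  show ?thesis
    unfolding e[OF s(1)] e[OF s(2)] e[OF s(3)] sym_pderiv_add
    by (simp only: distrib_right sum.distrib)
qed

lemma poisson_mult_left: "poisson (p * q) r = p * poisson q r + poisson p r * q"
proof -
  define E where
    "E i j = sym_emb (witt_bracket (sg i 1) (sg j (1::'a)))" for i j
  define A where "A = sym_vars (p * q) \<union> sym_vars p \<union> sym_vars q"
  have e: "poisson x r = (\<Sum>i\<in>A. \<Sum>j\<in>sym_vars r. sym_pderiv i x * sym_pderiv j r * E i j)"
    if "sym_vars x \<subseteq> A" for x
    unfolding E_def using that by (intro poisson_eq) (auto simp: A_def)
  have s: "sym_vars (p * q) \<subseteq> A" "sym_vars p \<subseteq> A" "sym_vars q \<subseteq> A"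
    by (auto simp: A_def)
  show ?thesis
    unfolding e[OF s(1)] e[OF s(2)] e[OF s(3)] sym_pderiv_mult sum_distrib_left
      sum_distrib_right sum.distrib[symmetric]
    by (intro sum.cong refl) (simp add: algebra_simps)
qed

lemma poisson_const: "poisson (sym_const c) q = 0"
  by (simp add: poisson_def sym_const_def sym_vars_def)

lemma poisson_emb: "poisson (sym_emb u) (sym_emb v) = sym_emb (witt_bracket u v)"
proof -
  have right: "poisson p (q + r) = poisson p q + poisson p r" for p q r :: "'a sym"
  proof -
    have "poisson p (q + r) = - (poisson q p + poisson r p)"
      by (subst poisson_antisym) (simp only: poisson_add_left)
    also have "\<dots> = poisson p q + poisson p r"
      using poisson_antisym[of q p] poisson_antisym[of r p] by simp
    finally show ?thesis .
  qed
  show ?thesis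
  proof (induction u rule: pm_induct)
    case (single i a)
    show ?case
    proof (induction v rule: pm_induct)
      case (single j b)
      have "poisson (sg (sg i 1) a) (sg (sg j 1) b) =
          (\<Sum>i'\<in>{i}. \<Sum>j'\<in>{j}. sym_pderiv i' (sg (sg i 1) a) * sym_pderiv j' (sg (sg j 1) b) *
             sym_emb (witt_bracket (sg i' 1) (sg j' 1)))"
        by (rule poisson_eq) (auto simp: sym_vars_def)
      then show ?case
        by (simp add: witt_bracket_single mult_single algebra_simps)
    qed (simp add: sym_emb_add right witt_bracket_add_right)
  qed (simp add: sym_emb_add poisson_add_left witt_bracket_add_left)
qed

lemma witt_bracket_closed:
  assumes "g \<in> {Witt, Witt_ge_m1, Witt_ge_1}" "u \<in> g" "v \<in> g"
  shows "witt_bracket u v \<in> g"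
proof -
  have gen: "ky (witt_bracket u v) \<subseteq> {N..}"
    if N: "N = 0 \<or> N = 2" and u: "ky u \<subseteq> {N..}" and v: "ky v \<subseteq> {N..}" for N :: int
  proof
    fix k assume k: "k \<in> ky (witt_bracket u v)"
    have add: "ky (\<Sum>x\<in>X. h x) \<subseteq> (\<Union>x\<in>X. ky (h x))" if "finite X"
      for X :: "int set" and h :: "int \<Rightarrow> 'a laurent"
      using that by (induction) (use keys_add in fastforce)+
    have bs: "witt_bracket (\<Sum>x\<in>X. h x) f = (\<Sum>x\<in>X. witt_bracket (h x) f)" if "finite X"
      for X :: "int set" and h :: "int \<Rightarrow> 'a laurent" and f
      using that
      by (induction) (simp_all add: witt_bracket_add_left, simp add: witt_bracket_def laurent_deriv_def)
    have bs': "witt_bracket f (\<Sum>x\<in>X. h x) = (\<Sum>x\<in>X. witt_bracket f (h x))" if "finite X"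
      for X :: "int set" and h :: "int \<Rightarrow> 'a laurent" and f
      using that
      by (induction) (simp_all add: witt_bracket_add_right, simp add: witt_bracket_def laurent_deriv_def)
    have "witt_bracket (\<Sum>i\<in>ky u. sg i (lk u i)) (\<Sum>j\<in>ky v. sg j (lk v j)) =
        (\<Sum>i\<in>ky u. \<Sum>j\<in>ky v. witt_bracket (sg i (lk u i)) (sg j (lk v j)))"
      by (subst sum.swap) (simp only: bs[OF finite_keys] bs'[OF finite_keys])
    then have "k \<in> ky (\<Sum>i\<in>ky u. \<Sum>j\<in>ky v. witt_bracket (sg i (lk u i)) (sg j (lk v j)))"
      using k by (simp only: pm_expand[symmetric])
    then obtain i where i: "i \<in> ky u"
      "k \<in> ky (\<Sum>j\<in>ky v. witt_bracket (sg i (lk u i)) (sg j (lk v j)))"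
      using add[OF finite_keys] by blast
    then obtain j where ij: "i \<in> ky u" "j \<in> ky v"
      "k \<in> ky (witt_bracket (sg i (lk u i)) (sg j (lk v j)))"
      using add[OF finite_keys] by blast
    then have "k = i + j - 1" "i \<noteq> j"
      by (auto simp: witt_bracket_single split: if_splits)
    moreover have "i \<ge> N" "j \<ge> N" using ij u v by auto
    ultimately show "k \<in> {N..}" using N by auto
  qed
  show ?thesis
    using assms gen[of 0] gen[of 2] by (auto simp: Witt_def Witt_ge_m1_def Witt_ge_1_def)
qed

lemma Sym_poisson_closed:
  assumes g: "g \<in> {Witt, Witt_ge_m1, Witt_ge_1}" and "p \<in> Sym g" "q \<in> Sym g"
  shows "poisson p q \<in> Sym g"
proof -
  have neg: "- r \<in> Sym g" if "r \<in> Sym g" for r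
  proof -
    have "- r = sym_const (- 1) * r" by (simp add: sym_const_def single_uminus)
    then show ?thesis using that Sym.const Sym.mult by metis
  qed
  have z: "(0::'a sym) \<in> Sym g" using Sym.const[of 0 g] by (simp add: sym_const_def)
  have emb_left: "poisson (sym_emb u) r \<in> Sym g" if u: "u \<in> g" and "r \<in> Sym g" for u r
  proof -
    have "poisson r (sym_emb u) \<in> Sym g" using that(2)
    proof induction
      case (const c)
      show ?case by (simp only: poisson_const z)
    next
      case (emb v)
      show ?case
        unfolding poisson_emb by (rule Sym.emb[OF witt_bracket_closed[OF g emb u]])
    next
      case (add a b)
      show ?case unfolding poisson_add_left by (rule Sym.add[OF add.IH])
    next
      case (mult a b)
      show ?case
        unfolding poisson_mult_left
        by (intro Sym.add Sym.mult mult.IH mult.hyps)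
    qed
    from neg[OF this] show ?thesis by (subst poisson_antisym)
  qed
  show ?thesis using assms(2)
  proof induction
    case (const c)
    show ?case by (simp only: poisson_const z)
  next
    case (emb v)
    show ?case by (rule emb_left[OF emb assms(3)])
  next
    case (add a b)
    show ?case unfolding poisson_add_left by (rule Sym.add[OF add.IH])
  next
    case (mult a b)
    show ?case
      unfolding poisson_mult_left
      by (intro Sym.add Sym.mult mult.IH mult.hyps)
  qed
qed

text \<open>
  \<open>A\<close> is a commutative algebra over \<open>'k\<close> via \<open>\<phi>\<close>, and \<open>f\<close> is linear on the span \<open>g\<close> of the
  $t^n\partial$ with $n \in N$.
\<close>

lemma Sym_universal:
  fixes \<phi> :: "'k::comm_ring_1 \<Rightarrow> 'A::comm_ring_1" and f :: "'k laurent \<Rightarrow> 'A" and N :: "int set"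
  defines "g \<equiv> {u :: 'k laurent. Poly_Mapping.keys u \<subseteq> N}"
  assumes \<phi>: "\<phi> 1 = 1" "\<And>a b. \<phi> (a + b) = \<phi> a + \<phi> b" "\<And>a b. \<phi> (a * b) = \<phi> a * \<phi> b"
    and f: "\<And>u v. u \<in> g \<Longrightarrow> v \<in> g \<Longrightarrow> f (u + v) = f u + f v"
      "\<And>c u. u \<in> g \<Longrightarrow> f (Poly_Mapping.single 0 c * u) = \<phi> c * f u"
  shows "\<exists>F. (\<forall>c. F (sym_const c) = \<phi> c) \<and> (\<forall>u\<in>g. F (sym_emb u) = f u) \<and>
    (\<forall>p\<in>Sym g. \<forall>q\<in>Sym g. F (p + q) = F p + F q \<and> F (p * q) = F p * F q)"
proof -
  have \<phi>0: "\<phi> 0 = 0" using \<phi>(2)[of 0 0] by simp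
  define x where "x i = (if i \<in> N then f (sg i 1) else 0)" for i
  define M where "M m = (\<Prod>i\<in>ky m. x i ^ lk m i)" for m :: "int \<Rightarrow>\<^sub>0 nat"
  define F where "F p = (\<Sum>m\<in>ky p. \<phi> (lk p m) * M m)" for p :: "'k sym"
  have M_eq: "M m = (\<Prod>i\<in>A. x i ^ lk m i)" if "finite A" "ky m \<subseteq> A" for A m
    unfolding M_def using that by (intro prod.mono_neutral_left) (auto simp: in_keys_iff)
  have M_add: "M (m + n) = M m * M n" for m n
  proof -
    let ?A = "ky m \<union> ky n \<union> ky (m + n)"
    have "M (m + n) = (\<Prod>i\<in>?A. x i ^ lk (m + n) i)" "M m = (\<Prod>i\<in>?A. x i ^ lk m i)"
      "M n = (\<Prod>i\<in>?A. x i ^ lk n i)"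
      by (rule M_eq; auto)+
    then show ?thesis by (simp only: lookup_add power_add prod.distrib)
  qed
  have F_add: "F (p + q) = F p + F q" for p q
    unfolding F_def by (rule sum_keys_add) (simp_all add: \<phi> \<phi>0 algebra_simps)
  have F_sg: "F (sg m c) = \<phi> c * M m" for m c
    by (cases "c = 0") (simp_all add: F_def \<phi>0)
  have F_mult: "F (p * q) = F p * F q" for p q
  proof (induction p rule: pm_induct)
    case (single m a)
    show ?case
      by (induction q rule: pm_induct)
         (simp_all add: mult_single F_sg M_add \<phi> F_add algebra_simps)
  qed (simp add: F_add algebra_simps)
  have F_emb: "F (sym_emb u) = f u" if u: "u \<in> g" for u
  proof -
    have f0: "f 0 = 0" using f(1)[of 0 0] by (simp add: g_def)
    have "F (sym_emb (\<Sum>m\<in>A. sg m (lk u m))) = f (\<Sum>m\<in>A. sg m (lk u m)) \<and>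
        (\<Sum>m\<in>A. sg m (lk u m)) \<in> g" if "finite A" "A \<subseteq> N" for A
      using that
    proof induction
      case empty
      show ?case by (simp add: f0 g_def F_def)
    next
      case (insert n A)
      have n: "sg n c \<in> g" for c :: 'k using insert.prems by (auto simp: g_def split: if_splits)
      have "f (sg n (lk u n)) = \<phi> (lk u n) * f (sg n 1)"
        using f(2)[OF n, of "lk u n" 1] by (simp add: mult_single)
      moreover have "M (sg n 1) = f (sg n 1)"
        using insert.prems by (simp add: M_def x_def)
      moreover have "a + b \<in> g" if "a \<in> g" "b \<in> g" for a b
        using that keys_add[of a b] by (auto simp: g_def)
      ultimately show ?case
        using insert n by (simp add: sym_emb_add F_add F_sg f)
    qed
    from this[OF finite_keys[of u]] u show ?thesis
      by (simp add: g_def pm_expand[symmetric])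
  qed
  show ?thesis
    by (rule exI[of _ F]) (simp add: F_add F_mult F_emb sym_const_def F_sg M_def)
qed

lemma Sym_universal_unique:
  assumes "\<And>c. F (sym_const c) = G (sym_const c)" "\<And>u. u \<in> g \<Longrightarrow> F (sym_emb u) = G (sym_emb u)"
    and "\<And>p q. p \<in> Sym g \<Longrightarrow> q \<in> Sym g \<Longrightarrow> F (p + q) = F p + F q \<and> F (p * q) = F p * F q"
    and "\<And>p q. p \<in> Sym g \<Longrightarrow> q \<in> Sym g \<Longrightarrow> G (p + q) = G p + G q \<and> G (p * q) = G p * G q"
    and "p \<in> Sym g"
  shows "F p = (G p :: 'A::comm_ring_1)"
  using assms(5)
proof (induction rule: Sym.induct)
  case (const c)
  show ?case by (rule assms(1))
next
  case (emb u)
  then show ?case by (rule assms(2))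
next
  case (add p q)
  then show ?case using assms(3)[of p q] assms(4)[of p q] by metis
next
  case (mult p q)
  then show ?case using assms(3)[of p q] assms(4)[of p q] by metis
qed

lemma cring_Sym_ring: "cring (Sym_ring g)"
proof (rule cringI)
  have z: "0 \<in> Sym g" using Sym.const[of 0 g] by (simp add: sym_const_def)
  have o: "1 \<in> Sym g" using Sym.const[of 1 g] by (simp add: sym_const_def)
  have neg: "- p \<in> Sym g" if "p \<in> Sym g" for p
    using Sym.mult[OF Sym.const[of "- 1" g] that] by (simp add: sym_const_def single_uminus)
  show "abelian_group (Sym_ring g)"
  proof (rule abelian_groupI)
    show "\<exists>y\<in>carrier (Sym_ring g). y \<oplus>\<^bsub>Sym_ring g\<^esub> x = \<zero>\<^bsub>Sym_ring g\<^esub>"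
      if "x \<in> carrier (Sym_ring g)" for x
      using that by (intro bexI[of _ "- x"]) (auto simp: Sym_ring_def neg)
  qed (auto simp: Sym_ring_def z algebra_simps intro: Sym.add)
  show "comm_monoid (Sym_ring g)"
    by (rule comm_monoidI) (auto simp: Sym_ring_def o algebra_simps intro: Sym.mult)
qed (auto simp: Sym_ring_def algebra_simps)

end

theory Submission
  imports Defs "Jordan_Normal_Form.Determinant"
begin

text \<open>
  Write $e_i = t^i\partial$.  Below every nonzero prime Poisson ideal $Q$ of $S(\mathfrak g)$
  there is another nonzero prime Poisson ideal $P \subsetneq Q$, so that chains ending in $Q$ can
  be made arbitrarily long.

  Geometrically, $P$ consists of the functions that vanish on all $\chi + y\,\mathrm{ev}_x$, where
  \<open>\<chi>\<close> is a zero of $Q$ and $y\,\mathrm{ev}_x$ sends $f\partial$ to $y f(x)$.  Algebraically, let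
  \<open>T\<close> be the substitution $e_i \mapsto e_i + y x^i$ with values in $S(\mathfrak g)[x^{\pm1},y^{\pm1}]$, and
  let $P$ be the preimage under \<open>T\<close> of the Laurent polynomials with coefficients in $Q$.  This is a
  prime ideal.  It is a Poisson ideal, because vector fields act on the pairs $(x, y)$ as on
  a cotangent bundle and \<open>T\<close> is equivariant (\<open>T_poisson\<close>).

  The inclusion $P \subseteq Q$ is seen at $y = 0$.  It is strict (\<open>point_prime_strict\<close>): the
  coefficients of $y$ in $T(p)$ are the partial derivatives of $p$, and a nonzero element of $Q$
  of least degree has one that is not in $Q$.

  What remains is $P \neq 0$ (\<open>point_prime_nonzero\<close>), and here the Lie algebra enters.  For
  $p \in Q$ put $U = \sum_i (\partial p/\partial e_i)\,t^i$.  As $\{p, e_j\} \in Q$ for all $j$, the generic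
  point \<open>\<chi>\<close> of the zero set of $Q$ satisfies $\chi(Ug' - U'g) = 0$ for all $g\partial \in \mathfrak g$.
  With a second element $q \in Q$ and its vector field $V$, the choices $g = Vh$ for $U$ and $g = Uh$
  for $V$ give $2\chi((UV' - U'V)h) = 0$.  For $q = \{p, e_J\}$ with $J$ large the coefficients
  \<open>w\<close> of $UV' - U'V$ do not all vanish modulo $Q$; so the variables satisfy a nontrivial linear
  recurrence modulo $Q$ (\<open>ex_recurrence\<close>).  Adding $y\,\mathrm{ev}_x$ replaces
  the recurrence $w$ by $(t - x)w$.  Hence a Hankel determinant $\det(e_{s+i+j})$ of sufficiently large size,
  which is a nonzero polynomial, lies in $P$.
\<close>



section \<open>Primes in subrings and Laurent polynomials over them\<close>

text \<open>
  $S(\mathfrak g)$ and the Laurent polynomials over it are subrings of types that are rings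
  themselves.  Keeping the subring \<open>A\<close> as a set, and the prime \<open>Q\<close> of \<open>A\<close> as another one, gives
  access to the ring operations, sums and determinants of the ambient type.
\<close>

locale prime_of_subring =
  fixes A Q :: "'a::comm_ring_1 set"
  assumes one_A: "1 \<in> A"
    and add_A: "a \<in> A \<Longrightarrow> b \<in> A \<Longrightarrow> a + b \<in> A"
    and uminus_A: "a \<in> A \<Longrightarrow> - a \<in> A"
    and mult_A: "a \<in> A \<Longrightarrow> b \<in> A \<Longrightarrow> a * b \<in> A"
    and Q_subset: "Q \<subseteq> A"
    and zero_Q: "0 \<in> Q"
    and add_Q: "p \<in> Q \<Longrightarrow> q \<in> Q \<Longrightarrow> p + q \<in> Q"
    and mult_Q: "a \<in> A \<Longrightarrow> q \<in> Q \<Longrightarrow> a * q \<in> Q"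
    and one_notin_Q: "1 \<notin> Q"
    and prime_Q: "a \<in> A \<Longrightarrow> b \<in> A \<Longrightarrow> a * b \<in> Q \<Longrightarrow> a \<in> Q \<or> b \<in> Q"
begin

lemma zero_A: "0 \<in> A"
  using zero_Q Q_subset by auto

lemma mult_Q_right: "q \<in> Q \<Longrightarrow> a \<in> A \<Longrightarrow> q * a \<in> Q"
  using mult_Q[of a q] by (simp add: mult.commute)

lemma uminus_Q: "q \<in> Q \<Longrightarrow> - q \<in> Q"
  using mult_Q[of "- 1" q] one_A uminus_A by simp

lemma diff_Q: "p \<in> Q \<Longrightarrow> q \<in> Q \<Longrightarrow> p - q \<in> Q"
  using add_Q[of p "- q"] uminus_Q by simp

lemma add_Q_cancel: "q \<in> Q \<Longrightarrow> p + q \<in> Q \<longleftrightarrow> p \<in> Q"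
  using add_Q[of p q] diff_Q[of "p + q" q] by auto

lemma diff_A: "a \<in> A \<Longrightarrow> b \<in> A \<Longrightarrow> a - b \<in> A"
  using add_A[of a "- b"] uminus_A by simp

lemma sum_A: "(\<And>i. i \<in> X \<Longrightarrow> f i \<in> A) \<Longrightarrow> sum f X \<in> A"
  by (induction X rule: infinite_finite_induct) (auto simp: zero_A intro: add_A)

lemma sum_Q: "(\<And>i. i \<in> X \<Longrightarrow> f i \<in> Q) \<Longrightarrow> sum f X \<in> Q"
  by (induction X rule: infinite_finite_induct) (auto simp: zero_Q intro: add_Q)

lemma prod_A: "(\<And>i. i \<in> X \<Longrightarrow> f i \<in> A) \<Longrightarrow> prod f X \<in> A"
  by (induction X rule: infinite_finite_induct) (auto simp: one_A intro: mult_A)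

lemma power_A: "a \<in> A \<Longrightarrow> a ^ n \<in> A"
  by (induction n) (auto simp: one_A intro: mult_A)

lemma det_A:
  assumes M: "M \<in> carrier_mat n n" and e: "\<And>i j. i < n \<Longrightarrow> j < n \<Longrightarrow> M $$ (i, j) \<in> A"
  shows "det M \<in> A"
  unfolding det_def'[OF M]
proof (intro sum_A mult_A prod_A)
  fix \<pi> i assume "\<pi> \<in> {\<pi>. \<pi> permutes {0..<n}}" "i \<in> {0..<n}"
  then show "M $$ (i, \<pi> i) \<in> A"
    using e[of i "\<pi> i"] permutes_in_image[of \<pi> "{0..<n}" i] by auto
next
  fix \<pi> :: "nat \<Rightarrow> nat"
  show "signof \<pi> \<in> A" using one_A uminus_A[OF one_A] by (cases "evenperm \<pi>") (simp_all add: sign_def)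
qed

text \<open>
  Cramer's rule modulo the prime \<open>Q\<close>: multiplying $Mz \equiv 0$ by the adjugate of $M$ gives
  $\det M\cdot z \equiv 0$, so that an entry of \<open>z\<close> outside \<open>Q\<close> forces $\det M \in Q$.
\<close>

lemma det_in_prime:
  assumes M: "M \<in> carrier_mat n n" and e: "\<And>i j. i < n \<Longrightarrow> j < n \<Longrightarrow> M $$ (i, j) \<in> A"
    and z: "\<And>j. j < n \<Longrightarrow> z j \<in> A"
    and ker: "\<And>i. i < n \<Longrightarrow> (\<Sum>j<n. M $$ (i, j) * z j) \<in> Q"
    and k: "k < n" "z k \<notin> Q"
  shows "det M \<in> Q"
proof -
  have cof: "cofactor M i k \<in> A" if i: "i < n" for i
    unfolding cofactor_def
  proof (intro mult_A power_A uminus_A one_A det_A)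
    show "mat_delete M i k \<in> carrier_mat (n - 1) (n - 1)" using M by (rule mat_delete_carrier)
    fix a b assume "a < n - 1" "b < n - 1"
    then show "mat_delete M i k $$ (a, b) \<in> A"
      using M e by (auto simp: mat_delete_def)
  qed
  have adj: "(\<Sum>i<n. M $$ (i, j) * cofactor M i k) = (if j = k then det M else 0)"
    if j: "j < n" for j
  proof -
    have "(adj_mat M * M) $$ (k, j) = (\<Sum>i<n. M $$ (i, j) * cofactor M i k)"
      unfolding times_mat_def scalar_prod_def adj_mat_def using j k M
      by (auto intro!: sum.cong simp: lessThan_atLeast0 mult.commute)
    then show ?thesis using adj_mat(3)[OF M] j k by auto
  qed
  have "det M * z k = (\<Sum>j<n. (\<Sum>i<n. M $$ (i, j) * cofactor M i k) * z j)"
    using k(1) by (simp add: adj if_distrib[of "\<lambda>c. c * _"] cong: if_cong)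
  also have "\<dots> = (\<Sum>i<n. cofactor M i k * (\<Sum>j<n. M $$ (i, j) * z j))"
    unfolding sum_distrib_left sum_distrib_right
    by (subst sum.swap) (simp add: mult_ac)
  also have "\<dots> \<in> Q"
    by (intro sum_Q mult_Q cof ker) auto
  finally show ?thesis
    using prime_Q[OF det_A[OF M e] z[OF k(1)]] k(2) by blast
qed

end

definition coeffs_in :: "'a::zero set \<Rightarrow> ('m \<Rightarrow>\<^sub>0 'a) set" where
  "coeffs_in X = {F. \<forall>m. Poly_Mapping.lookup F m \<in> X}"

lemma coeffs_inD: "F \<in> coeffs_in X \<Longrightarrow> lk F m \<in> X"
  by (simp add: coeffs_in_def)

lemma lookup_mult_keys:
  fixes F G :: "'m::comm_monoid_add \<Rightarrow>\<^sub>0 'a::comm_ring_1"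
  shows "lk (F * G) k = (\<Sum>a\<in>ky F. \<Sum>b\<in>ky G. if a + b = k then lk F a * lk G b else 0)"
proof -
  have "F * G = (\<Sum>a\<in>ky F. sg a (lk F a)) * (\<Sum>b\<in>ky G. sg b (lk G b))"
    by (simp only: pm_expand[symmetric])
  also have "\<dots> = (\<Sum>a\<in>ky F. \<Sum>b\<in>ky G. sg (a + b) (lk F a * lk G b))"
    by (simp only: sum_distrib_left sum_distrib_right mult_single)
       (rule sum.swap)
  finally show ?thesis by (simp add: lookup_sum lookup_single when_def)
qed

context prime_of_subring
begin

lemma single_coeffs_in: "c \<in> A \<Longrightarrow> sg m c \<in> coeffs_in A" "c \<in> Q \<Longrightarrow> sg m c \<in> coeffs_in Q"
  using zero_A zero_Q by (auto simp: coeffs_in_def lookup_single when_def)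

text \<open>
  Apart from $(M, N)$ every pair of exponents with sum $M + N$ has one that is above \<open>M\<close> or
  above \<open>N\<close>, where the coefficients lie in \<open>Q\<close>.
\<close>

lemma lookup_mult_leading:
  fixes F G :: "'m::linordered_ab_group_add \<Rightarrow>\<^sub>0 'a"
  assumes FA: "F \<in> coeffs_in A" and GA: "G \<in> coeffs_in A"
    and F: "\<And>a. M < a \<Longrightarrow> lk F a \<in> Q" and G: "\<And>b. N < b \<Longrightarrow> lk G b \<in> Q"
  shows "lk (F * G) (M + N) - lk F M * lk G N \<in> Q"
proof -
  have FA': "lk F a \<in> A" and GA': "lk G a \<in> A" for a
    using FA GA by (auto simp: coeffs_in_def)
  let ?c = "\<lambda>a b. if a + b = M + N then lk F a * lk G b else 0"
  let ?c' = "\<lambda>a b. if a = M \<and> b = N then lk F a * lk G b else 0"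
  have "lk (F * G) (M + N) - (\<Sum>a\<in>ky F. \<Sum>b\<in>ky G. ?c' a b) =
    (\<Sum>a\<in>ky F. \<Sum>b\<in>ky G. ?c a b - ?c' a b)"
    by (simp add: lookup_mult_keys sum_subtractf)
  also have "\<dots> \<in> Q"
  proof (intro sum_Q)
    fix a b
    consider "a = M" "b = N" | "a + b \<noteq> M + N" | "M < a" | "N < b"
      using add_less_le_mono[of a M b N] add_le_less_mono[of a M b N]
      by (metis less_irrefl linorder_less_linear order_less_imp_le order_refl)
    then show "?c a b - ?c' a b \<in> Q"
      by cases (auto simp: zero_Q intro: mult_Q mult_Q_right F G FA' GA')
  qed
  also have "(\<Sum>a\<in>ky F. \<Sum>b\<in>ky G. ?c' a b) = lk F M * lk G N"
  proof -
    have "(\<Sum>a\<in>ky F. \<Sum>b\<in>ky G. ?c' a b) =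
        (\<Sum>a\<in>ky F. if a = M then (\<Sum>b\<in>ky G. if b = N then lk F a * lk G b else 0) else 0)"
      by (intro sum.cong refl) (auto intro!: sum.neutral)
    then show ?thesis by (auto simp: in_keys_iff)
  qed
  finally show ?thesis .
qed

text \<open>
  Gauss' lemma: the exponents form a linearly ordered group, so that two Laurent polynomials
  with coefficients not all in \<open>Q\<close> have leading terms modulo \<open>Q\<close>, and these multiply.
\<close>

lemma prime_of_subring_coeffs_in:
  "prime_of_subring (coeffs_in A :: ('m::linordered_ab_group_add \<Rightarrow>\<^sub>0 'a) set) (coeffs_in Q)"
proof
  show "1 \<in> (coeffs_in A :: ('m \<Rightarrow>\<^sub>0 'a) set)"
    using one_A zero_A by (auto simp: coeffs_in_def lookup_one when_def)
  show "coeffs_in Q \<subseteq> (coeffs_in A :: ('m \<Rightarrow>\<^sub>0 'a) set)"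
    using Q_subset by (auto simp: coeffs_in_def)
  show "0 \<in> (coeffs_in Q :: ('m \<Rightarrow>\<^sub>0 'a) set)"
    using zero_Q by (auto simp: coeffs_in_def)
  show "1 \<notin> (coeffs_in Q :: ('m \<Rightarrow>\<^sub>0 'a) set)"
    using one_notin_Q by (auto simp: coeffs_in_def lookup_one when_def)
  fix a b :: "'m \<Rightarrow>\<^sub>0 'a"
  show "a + b \<in> coeffs_in A" "- a \<in> coeffs_in A" "a * b \<in> coeffs_in A"
    if "a \<in> coeffs_in A" "b \<in> coeffs_in A" using that
    by (auto simp: coeffs_in_def lookup_add lookup_mult_keys zero_A
        intro: add_A uminus_A intro!: sum_A mult_A)
  show "a + b \<in> coeffs_in Q" if "a \<in> coeffs_in Q" "b \<in> coeffs_in Q" using that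
    by (auto simp: coeffs_in_def lookup_add intro: add_Q)
  show "a * b \<in> coeffs_in Q" if "a \<in> coeffs_in A" "b \<in> coeffs_in Q" using that
    by (auto simp: coeffs_in_def lookup_mult_keys zero_Q intro!: sum_Q mult_Q)
  show "a \<in> coeffs_in Q \<or> b \<in> coeffs_in Q"
    if A: "a \<in> coeffs_in A" "b \<in> coeffs_in A" and ab: "a * b \<in> coeffs_in Q"
  proof (rule ccontr)
    assume notin: "\<not> (a \<in> coeffs_in Q \<or> b \<in> coeffs_in Q)"
    have top: "\<exists>M. lk F M \<notin> Q \<and> (\<forall>k. M < k \<longrightarrow> lk F k \<in> Q)"
      if "F \<notin> coeffs_in Q" for F :: "'m \<Rightarrow>\<^sub>0 'a"
    proof -
      let ?X = "{k \<in> ky F. lk F k \<notin> Q}"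
      have "?X \<noteq> {}" using that zero_Q by (auto simp: coeffs_in_def in_keys_iff) metis
      then have "Max ?X \<in> ?X" by (intro Max_in) auto
      moreover have "lk F k \<in> Q" if "Max ?X < k" for k
      proof (rule ccontr)
        assume "lk F k \<notin> Q"
        then have "k \<in> ?X" using zero_Q by (auto simp: in_keys_iff)
        then have "k \<le> Max ?X" by (intro Max_ge) auto
        then show False using that by auto
      qed
      ultimately show ?thesis by blast
    qed
    obtain M where M: "lk a M \<notin> Q" "\<forall>k. M < k \<longrightarrow> lk a k \<in> Q"
      using top notin by blast
    obtain N where N: "lk b N \<notin> Q" "\<forall>k. N < k \<longrightarrow> lk b k \<in> Q"
      using top notin by blast
    have "lk (a * b) (M + N) - lk a M * lk b N \<in> Q"
      by (rule lookup_mult_leading[OF A]) (use M N in auto)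
    moreover have "lk (a * b) (M + N) \<in> Q" using ab by (rule coeffs_inD)
    ultimately have "lk a M * lk b N \<in> Q" using diff_Q by fastforce
    then show False
      using prime_Q[of "lk a M" "lk b N"] A M N by (auto dest: coeffs_inD)
  qed
qed

end


section \<open>Prime Poisson ideals of the symmetric algebra\<close>

text \<open>
  All three Lie algebras are spanned by the $t^n\partial$ with exponents \<open>n\<close> in a set \<open>N\<close>.
\<close>

abbreviation vspan :: "int set \<Rightarrow> 'k::comm_ring_1 laurent set" where
  "vspan N \<equiv> {f. Poly_Mapping.keys f \<subseteq> N}"

definition sym_var :: "int \<Rightarrow> 'k::comm_ring_1 sym" where
  "sym_var i = sym_emb (sg i 1)"

lemma sym_const_simps:
  "sym_const 0 = 0" "sym_const 1 = 1" "sym_const (a + b) = sym_const a + sym_const b"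
  "sym_const (a * b) = sym_const a * sym_const b" "sym_const (- a) = - sym_const a"
  "sym_const (a - b) = sym_const a - sym_const b"
  by (simp_all add: sym_const_def single_add mult_single single_uminus single_diff)

lemma sym_emb_var: "sym_emb (sg i c) = sym_const c * sym_var i"
  using sym_emb_scale[of c "sg i 1"] by (simp add: sym_var_def mult_single del: sym_emb_single)

lemma sym_const_of_int: "sym_const (of_int n) = of_int n"
proof (induction n rule: int_induct[of _ 0])
  case base
  show ?case by (simp add: sym_const_simps)
qed (simp_all add: sym_const_simps)

lemma zero_Sym: "0 \<in> Sym g"
  using Sym.const[of 0 g] by (simp add: sym_const_simps)

lemma one_Sym: "1 \<in> Sym g"
  using Sym.const[of 1 g] by (simp add: sym_const_simps)

lemma uminus_Sym: "p \<in> Sym g \<Longrightarrow> - p \<in> Sym g"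
  using Sym.mult[OF Sym.const[of "- 1" g], of p] by (simp add: sym_const_simps)

lemma primeideal_Sym_iff:
  "primeideal Q (Sym_ring g) \<longleftrightarrow> prime_of_subring (Sym g) Q"
proof
  assume "primeideal Q (Sym_ring g)"
  then interpret primeideal Q "Sym_ring g" .
  have sub: "Q \<subseteq> Sym g" using a_subset by (simp add: Sym_ring_def)
  show "prime_of_subring (Sym g) Q"
  proof
    show "1 \<notin> Q"
    proof
      assume "1 \<in> Q"
      then have "Sym g \<subseteq> Q" using I_l_closed[of 1] by (auto simp: Sym_ring_def)
      then show False using I_notcarr sub by (auto simp: Sym_ring_def)
    qed
    show "0 \<in> Q" using additive_subgroup.zero_closed[OF additive_subgroup_axioms] by (simp add: Sym_ring_def)
    show "p + q \<in> Q" if "p \<in> Q" "q \<in> Q" for p q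
      using additive_subgroup.a_closed[OF additive_subgroup_axioms that] by (simp add: Sym_ring_def)
    show "a * q \<in> Q" if "a \<in> Sym g" "q \<in> Q" for a q
      using I_l_closed[of q a] that by (simp add: Sym_ring_def)
    show "a \<in> Q \<or> b \<in> Q" if "a \<in> Sym g" "b \<in> Sym g" "a * b \<in> Q" for a b
      using I_prime[of a b] that by (simp add: Sym_ring_def)
  qed (auto simp: one_Sym uminus_Sym sub[THEN subsetD] intro: Sym.add Sym.mult)
next
  assume "prime_of_subring (Sym g) Q"
  then interpret prime_of_subring "Sym g" Q .
  interpret cring "Sym_ring g" by (rule cring_Sym_ring)
  have inv: "inv\<^bsub>add_monoid (Sym_ring g)\<^esub> p = - p" if "p \<in> Q" for p
  proof -
    have "\<ominus>\<^bsub>Sym_ring g\<^esub> p = - p"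
      using that Q_subset by (intro minus_equality) (auto simp: Sym_ring_def uminus_Sym)
    then show ?thesis by (simp add: a_inv_def)
  qed
  show "primeideal Q (Sym_ring g)"
  proof (rule primeidealI)
    show "ideal Q (Sym_ring g)"
    proof (rule idealI)
      show "subgroup Q (add_monoid (Sym_ring g))"
        by (rule subgroup.intro)
          (use Q_subset zero_Q add_Q uminus_Q inv in \<open>auto simp: Sym_ring_def\<close>)
    next
      show "ring (Sym_ring g)" by (rule ring_axioms)
    qed (auto simp: Sym_ring_def intro: mult_Q mult_Q_right)
    show "carrier (Sym_ring g) \<noteq> Q" using one_notin_Q one_Sym by (auto simp: Sym_ring_def)
    show "a \<in> Q \<or> b \<in> Q" if "a \<in> carrier (Sym_ring g)" "b \<in> carrier (Sym_ring g)"
      "a \<otimes>\<^bsub>Sym_ring g\<^esub> b \<in> Q" for a b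
      using prime_Q that by (auto simp: Sym_ring_def)
  qed (rule cring_Sym_ring)
qed

lemma poisson_add_right: "poisson r (p + q) = poisson r p + poisson r q"
  by (simp add: poisson_antisym[of r] poisson_add_left)

lemma poisson_mult_right: "poisson r (p * q) = p * poisson r q + poisson r p * q"
  by (simp add: poisson_antisym[of r] poisson_mult_left)

lemma poisson_const_right: "poisson p (sym_const c) = 0"
  by (simp add: poisson_antisym[of p] poisson_const)

text \<open>
  By the Leibniz rule an ideal is Poisson as soon as it is stable under the bracket with the
  variables of the algebra.
\<close>

lemma prime_poisson_ideal_iff:
  "prime_poisson_ideal (vspan N) Q \<longleftrightarrow>
     prime_of_subring (Sym (vspan N)) Q \<and> (\<forall>p\<in>Q. \<forall>j\<in>N. poisson p (sym_var j) \<in> Q)"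
proof (intro iffI conjI ballI; (elim conjE)?)
  assume "prime_poisson_ideal (vspan N) Q"
  then show "prime_of_subring (Sym (vspan N)) Q"
    by (simp add: prime_poisson_ideal_def primeideal_Sym_iff)
next
  fix p j assume "prime_poisson_ideal (vspan N) Q" "p \<in> Q" "j \<in> N"
  moreover have "sym_var j \<in> Sym (vspan N)"
    unfolding sym_var_def using \<open>j \<in> N\<close> by (intro Sym.emb) auto
  ultimately show "poisson p (sym_var j) \<in> Q"
    unfolding prime_poisson_ideal_def by blast
next
  assume P: "prime_of_subring (Sym (vspan N)) Q" and *: "\<forall>p\<in>Q. \<forall>j\<in>N. poisson p (sym_var j) \<in> Q"
  interpret prime_of_subring "Sym (vspan N)" Q by (rule P)
  have "poisson p q \<in> Q" if p: "p \<in> Q" and "q \<in> Sym (vspan N)" for p q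
    using that(2)
  proof induction
    case (const c)
    show ?case by (simp add: poisson_const_right zero_Q)
  next
    case (emb u)
    have emb0: "poisson p 0 = 0" using poisson_const_right[of p 0] by (simp add: sym_const_simps)
    have s: "poisson p (sym_emb (sum f X)) = (\<Sum>i\<in>X. poisson p (sym_emb (f i)))" if "finite X"
      for f and X :: "int set"
      using that by induction (simp_all add: sym_emb_add poisson_add_right emb0)
    have c: "poisson p (sym_emb (sg i c)) = sym_const c * poisson p (sym_var i)" for i c
      by (simp add: sym_emb_var poisson_mult_right poisson_const_right del: sym_emb_single)
    have "poisson p (sym_emb (\<Sum>i\<in>ky u. sg i (lk u i))) \<in> Q"
      unfolding s[OF finite_keys] c
      by (intro sum_Q mult_Q Sym.const) (use * p emb in auto)
    then show ?case by (simp only: pm_expand[symmetric])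
  next
    case (add a b)
    then show ?case by (simp add: poisson_add_right add_Q)
  next
    case (mult a b)
    then show ?case by (simp add: poisson_mult_right add_Q mult_Q mult_Q_right)
  qed
  then show "prime_poisson_ideal (vspan N) Q"
    using P by (simp add: prime_poisson_ideal_def primeideal_Sym_iff)
qed

section \<open>Partial derivatives\<close>

lemma sym_pderiv_zero: "sym_pderiv i 0 = 0"
  by (simp add: sym_pderiv_def)

lemma lookup_sym_pderiv:
  "lk (sym_pderiv i p) n = of_nat (Suc (lk n i)) * lk p (n + sg i 1)"
proof (induction p rule: pm_induct)
  case (single m c)
  have "m - sg i 1 = n \<longleftrightarrow> m = n + sg i 1" if "lk m i > 0"
    using that
    by (force simp: poly_mapping_eq_iff fun_eq_iff lookup_minus lookup_add lookup_single when_def)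
  then show ?case
    by (cases "lk m i = 0") (auto simp: lookup_single when_def lookup_add)
qed (simp add: sym_pderiv_add lookup_add algebra_simps)

lemma sym_pderiv_commute: "sym_pderiv i (sym_pderiv j p) = sym_pderiv j (sym_pderiv i p)"
  by (rule poly_mapping_eqI)
     (cases "i = j"; simp add: lookup_sym_pderiv lookup_add lookup_single algebra_simps)

lemma sym_pderiv_var: "sym_pderiv i (sym_var j) = (if i = j then 1 else 0)"
  using sym_pderiv_emb[of i "sg j 1"]
  by (auto simp: sym_var_def lookup_single when_def sym_const_simps simp del: sym_emb_single)

lemma sym_pderiv_const: "sym_pderiv i (sym_const c) = 0"
  by (simp add: sym_const_def)

lemma sym_pderiv_Sym:
  assumes "p \<in> Sym g" shows "sym_pderiv i p \<in> Sym g"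
  using assms
proof induction
  case (mult p q)
  then show ?case by (auto simp: sym_pderiv_mult intro: Sym.add Sym.mult)
qed (auto simp: sym_pderiv_const zero_Sym sym_pderiv_emb sym_pderiv_add intro: Sym.const Sym.add)

lemma sym_pderiv_outside:
  assumes "p \<in> Sym (vspan N)" "i \<notin> N" shows "sym_pderiv i p = 0"
  using assms
proof induction
  case (emb u)
  then have "lk u i = 0" by (auto simp: in_keys_iff)
  then show ?case by (simp add: sym_pderiv_emb sym_const_simps)
qed (auto simp: sym_pderiv_const sym_pderiv_add sym_pderiv_mult)

definition monom_deg :: "(int \<Rightarrow>\<^sub>0 nat) \<Rightarrow> nat" where
  "monom_deg m = (\<Sum>i\<in>ky m. lk m i)"

lemma monom_deg_add_var: "monom_deg (m + sg i 1) = Suc (monom_deg m)"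
proof -
  have "monom_deg (m + sg i 1) = monom_deg m + monom_deg (sg i 1)"
    unfolding monom_deg_def by (rule sum_keys_add) auto
  then show ?thesis by (simp add: monom_deg_def)
qed

text \<open>
  In characteristic zero a nonzero element of least degree cannot have all its partial
  derivatives in the prime: they would vanish, and the element would be a nonzero constant.
\<close>

lemma ex_sym_pderiv_notin:
  fixes Q :: "'k::field_char_0 sym set"
  assumes P: "prime_of_subring (Sym g) Q" and "Q \<noteq> {0}"
  obtains p i where "p \<in> Q" "sym_pderiv i p \<notin> Q"
proof -
  interpret prime_of_subring "Sym g" Q by (rule P)
  define D where "D p = Max (insert 0 (monom_deg ` ky p))" for p :: "'k sym"
  have D: "D p \<ge> monom_deg m" if "m \<in> ky p" for p m
    unfolding D_def using that by (intro Max_ge) auto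
  obtain p0 where "p0 \<in> Q - {0}" using assms(2) zero_Q by blast
  then obtain p where p: "p \<in> Q" "p \<noteq> 0" and min: "\<And>q. q \<in> Q \<Longrightarrow> q \<noteq> 0 \<Longrightarrow> D p \<le> D q"
    using ex_has_least_nat[of "\<lambda>p. p \<in> Q - {0}" p0 D] by blast
  show ?thesis
  proof (rule ccontr)
    assume "\<not> thesis"
    then have all: "sym_pderiv i p \<in> Q" for i using that p by blast
    have zero: "sym_pderiv i p = 0" for i
    proof (rule ccontr)
      assume nz: "sym_pderiv i p \<noteq> 0"
      have less: "monom_deg n < D p" if "n \<in> ky (sym_pderiv i p)" for n
      proof -
        have "n + sg i 1 \<in> ky p" using that by (auto simp: in_keys_iff lookup_sym_pderiv)
        from D[OF this] show ?thesis unfolding monom_deg_add_var by simp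
      qed
      obtain n where n: "n \<in> ky (sym_pderiv i p)" using nz by (metis all_not_in_conv keys_eq_empty)
      have "D (sym_pderiv i p) < D p"
        unfolding D_def[of "sym_pderiv i p"] using less less[OF n] by (subst Max_less_iff) auto
      then show False using min[OF all nz] by simp
    qed
    have "m = 0" if "m \<in> ky p" for m
    proof (rule ccontr)
      assume "m \<noteq> 0"
      then obtain i where i: "lk m i > 0" by (metis gr0I lookup_zero poly_mapping_eqI)
      have "m = (m - sg i 1) + sg i 1"
        using i by (intro poly_mapping_eqI) (auto simp: lookup_add lookup_minus lookup_single when_def)
      moreover have "lk p ((m - sg i 1) + sg i 1) = 0"
        using zero[of i] lookup_sym_pderiv[of i p "m - sg i 1"] by (simp del: of_nat_Suc)
      ultimately show False using that by (simp add: in_keys_iff)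
    qed
    then have ky: "ky p = {0}" using p(2) by (metis all_not_in_conv keys_eq_empty subset_singletonD subsetI singletonI)
    define c where "c = lk p 0"
    have pc: "p = sym_const c"
      by (subst pm_expand[of p]) (simp add: ky c_def sym_const_def)
    have "c \<noteq> 0" using ky by (auto simp: c_def in_keys_iff)
    then have "sym_const (inverse c) * p = 1"
      by (simp add: pc sym_const_def mult_single)
    then show False
      using mult_Q[OF Sym.const[of "inverse c"] p(1)] one_notin_Q by simp
  qed
qed


section \<open>A linear recurrence modulo a nonzero prime Poisson ideal\<close>

lemma laurent_deriv_mult: "laurent_deriv (f * g) = laurent_deriv f * g + f * laurent_deriv g"
proof (induction f rule: pm_induct)
  case (single m a)
  show ?case
  proof (induction g rule: pm_induct)
    case (single n b)
    have e: "m - 1 + n = m + n - 1" "m + (n - 1) = m + n - 1" by simp_all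
    show ?case by (simp add: mult_single e single_add[symmetric] algebra_simps)
  qed (simp add: laurent_deriv_add algebra_simps)
qed (simp add: laurent_deriv_add algebra_simps)

lemma lookup_laurent_deriv: "lk (laurent_deriv f) n = of_int (n + 1) * lk f (n + 1)"
  by (induction f rule: pm_induct)
     (auto simp: laurent_deriv_add lookup_add lookup_single when_def algebra_simps)

text \<open>
  The differential of \<open>p\<close> is the vector field $\sum_i (\partial p/\partial e_i)\,t^i$ with
  coefficients in the symmetric algebra, where $e_i = t^i\partial$ is variable number \<open>i\<close>.
\<close>

definition differential :: "'k::comm_ring_1 sym \<Rightarrow> 'k sym laurent" where
  "differential p = (\<Sum>i\<in>sym_vars p. sg i (sym_pderiv i p))"

lemma lookup_differential: "lk (differential p) i = sym_pderiv i p"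
  by (auto simp: differential_def lookup_sum lookup_single when_def sym_pderiv_notin)

text \<open>
  The generic point of the dual of the Witt algebra, extended linearly over the symmetric
  algebra: it sends $t^n$ to the variable $e_n$.
\<close>

definition generic_pairing :: "'k::comm_ring_1 sym laurent \<Rightarrow> 'k sym" where
  "generic_pairing F = (\<Sum>n\<in>ky F. lk F n * sym_var n)"

lemma generic_pairing_single [simp]: "generic_pairing (sg n c) = c * sym_var n"
  by (cases "c = 0") (simp_all add: generic_pairing_def)

lemma generic_pairing_add: "generic_pairing (F + G) = generic_pairing F + generic_pairing G"
  unfolding generic_pairing_def by (rule sum_keys_add) (simp_all add: algebra_simps)

lemma generic_pairing_zero: "generic_pairing 0 = 0"
  by (simp add: generic_pairing_def)

lemma generic_pairing_sum: "generic_pairing (sum F X) = (\<Sum>x\<in>X. generic_pairing (F x))"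
  by (induction X rule: infinite_finite_induct)
     (auto simp: generic_pairing_zero generic_pairing_add)

lemma generic_pairing_scale: "generic_pairing (sg 0 c * F) = c * generic_pairing F"
  by (induction F rule: pm_induct)
     (simp_all add: generic_pairing_add mult_single algebra_simps)

lemma witt_bracket_scale: "witt_bracket F (sg 0 c * G) = sg 0 c * witt_bracket F G"
  by (simp add: witt_bracket_def laurent_deriv_mult algebra_simps)

lemma witt_bracket_zero: "witt_bracket F 0 = 0" "witt_bracket 0 F = 0"
  by (simp_all add: witt_bracket_def laurent_deriv_def)

lemma witt_bracket_sum: "witt_bracket F (sum G X) = (\<Sum>x\<in>X. witt_bracket F (G x))"
  "witt_bracket (sum G X) F = (\<Sum>x\<in>X. witt_bracket (G x) F)"
  by (induction X rule: infinite_finite_induct)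
     (auto simp: witt_bracket_zero witt_bracket_add_left witt_bracket_add_right)

lemma poisson_var_sum:
  "poisson p (sym_var j) =
    (\<Sum>i\<in>sym_vars p. sym_const (of_int (j - i)) * sym_pderiv i p * sym_var (i + j - 1))"
proof -
  have "poisson p (sym_var j) = (\<Sum>i\<in>sym_vars p. \<Sum>j'\<in>{j}. sym_pderiv i p * sym_pderiv j' (sym_var j) *
           sym_emb (witt_bracket (sg i 1) (sg j' 1)))"
    by (rule poisson_eq) (auto simp: sym_vars_def sym_var_def)
  then show ?thesis
    by (simp add: sym_pderiv_var witt_bracket_single sym_emb_var mult_ac
        del: sym_emb_single of_int_diff)
qed

text \<open>
  The Kirillov--Kostant formula $\{p, e_j\}(\chi) = \chi([d_\chi p, e_j])$ at the generic point.
\<close>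

lemma poisson_var:
  "poisson p (sym_var j) = generic_pairing (witt_bracket (differential p) (sg j 1))"
  by (simp add: poisson_var_sum differential_def witt_bracket_sum generic_pairing_sum
      witt_bracket_single sym_const_of_int del: of_int_diff)

lemma sym_pderiv_sum: "sym_pderiv i (sum f X) = (\<Sum>x\<in>X. sym_pderiv i (f x))"
  by (induction X rule: infinite_finite_induct) (auto simp: sym_pderiv_zero sym_pderiv_add)

text \<open>
  The bracket with $t^j\partial$ shifts a variable $t^i\partial$ to $t^{i+j-1}\partial$; the
  variables outside \<open>p\<close> produced in this way occur linearly.
\<close>

lemma sym_pderiv_poisson_var:
  assumes "l \<notin> sym_vars p"
  shows "sym_pderiv l (poisson p (sym_var j)) =
    sym_const (of_int (j - (l - j + 1))) * sym_pderiv (l - j + 1) p"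
proof -
  have 0: "sym_pderiv l (sym_pderiv i p) = 0" for i
    by (simp add: sym_pderiv_commute[of l] sym_pderiv_notin[OF assms] sym_pderiv_zero)
  have "sym_pderiv l (poisson p (sym_var j)) =
      (\<Sum>i\<in>sym_vars p. if i = l - j + 1
         then sym_const (of_int (j - (l - j + 1))) * sym_pderiv (l - j + 1) p else 0)"
    unfolding poisson_var_sum sym_pderiv_sum
  proof (intro sum.cong refl)
    fix i
    have "l = i + j - 1 \<longleftrightarrow> i = l - j + 1" by auto
    then show "sym_pderiv l (sym_const (of_int (j - i)) * sym_pderiv i p * sym_var (i + j - 1)) =
      (if i = l - j + 1 then sym_const (of_int (j - (l - j + 1))) * sym_pderiv (l - j + 1) p else 0)"
      by (cases "i = l - j + 1")
        (simp_all only: sym_pderiv_mult sym_pderiv_const sym_pderiv_var 0 if_True if_False, simp_all)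
  qed
  also have "\<dots> = sym_const (of_int (j - (l - j + 1))) * sym_pderiv (l - j + 1) p"
    by (simp add: sym_pderiv_notin)
  finally show ?thesis .
qed

text \<open>
  The derivative of \<open>h\<close> cancels in the difference.  This turns a first order condition on the
  generic point into one that is linear over $\Bbbk[t]$.
\<close>

lemma witt_bracket_double:
  "witt_bracket U (V * h) - witt_bracket V (U * h) = 2 * witt_bracket U V * h"
  by (simp add: witt_bracket_def laurent_deriv_mult algebra_simps)

definition exponent_set :: "int set \<Rightarrow> bool" where
  "exponent_set N \<longleftrightarrow> N = UNIV \<or> N = {0..} \<or> N = {2..}"

text \<open>
  The prime Poisson ideals \<open>Q\<close> of $S(\mathfrak g)$ for the three Lie algebras at once; see
  \<open>witt_prime_iff\<close>.
\<close>

locale witt_prime =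
  fixes N :: "int set" and Q :: "'k::field_char_0 sym set"
  assumes N: "exponent_set N"
    and prime: "prime_of_subring (Sym (vspan N)) Q"
    and bracket: "p \<in> Q \<Longrightarrow> j \<in> N \<Longrightarrow> poisson p (sym_var j) \<in> Q"

sublocale witt_prime \<subseteq> prime_of_subring "Sym (vspan N)" Q
  by (rule prime)

context witt_prime
begin

lemma sym_var_Sym: "j \<in> N \<Longrightarrow> sym_var j \<in> Sym (vspan N)"
  unfolding sym_var_def by (intro Sym.emb) auto

lemma N_up: "j \<in> N \<Longrightarrow> 0 \<le> m \<Longrightarrow> j + m \<in> N"
  using N by (auto simp: exponent_set_def)

lemma of_int_cancel:
  assumes "a \<in> Sym (vspan N)" "of_int n * a \<in> Q" "n \<noteq> 0"
  shows "a \<in> Q"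
proof -
  have "sym_const (inverse (of_int n)) * (of_int n * a) =
      (sym_const (inverse (of_int n)) * sym_const (of_int n)) * a"
    by (simp add: sym_const_of_int mult_ac)
  also have "sym_const (inverse (of_int n)) * sym_const (of_int n) = (1 :: 'k sym)"
    using assms(3) by (simp flip: sym_const_simps(2,4))
  finally show ?thesis
    using mult_Q[OF Sym.const[of "inverse (of_int n)"] assms(2)] by (metis mult_1)
qed

lemma of_int_A: "of_int n \<in> Sym (vspan N)"
  using Sym.const[of "of_int n" "vspan N"] by (simp add: sym_const_of_int)

text \<open>
  The ideal \<open>Q\<close> is stable under all $\{\cdot, e_j\}$, so that modulo \<open>Q\<close> the differential of an
  element of \<open>Q\<close> stabilizes the generic point.
\<close>

lemma pairing_bracket_mem:
  assumes p: "p \<in> Q" and G: "G \<in> coeffs_in (Sym (vspan N))" "ky G \<subseteq> N"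
  shows "generic_pairing (witt_bracket (differential p) G) \<in> Q"
proof -
  have "G = (\<Sum>j\<in>ky G. sg 0 (lk G j) * sg j 1)"
    by (subst pm_expand[of G]) (simp add: mult_single)
  then have "generic_pairing (witt_bracket (differential p) G) =
      (\<Sum>j\<in>ky G. lk G j * generic_pairing (witt_bracket (differential p) (sg j 1)))"
    by (metis (no_types, lifting) generic_pairing_scale generic_pairing_sum sum.cong
        witt_bracket_scale witt_bracket_sum(1))
  also have "\<dots> \<in> Q"
    unfolding poisson_var[symmetric] using p G
    by (intro sum_Q mult_Q bracket) (auto simp: coeffs_in_def)
  finally show ?thesis .
qed

lemma differential_coeffs: "p \<in> Q \<Longrightarrow> differential p \<in> coeffs_in (Sym (vspan N))"
  using Q_subset by (auto simp: coeffs_in_def lookup_differential intro: sym_pderiv_Sym)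

lemma differential_keys: "p \<in> Q \<Longrightarrow> ky (differential p) \<subseteq> N"
  using Q_subset sym_pderiv_outside by (fastforce simp: in_keys_iff lookup_differential)

lemma keys_mult_power:
  fixes G :: "'k sym laurent"
  assumes "ky G \<subseteq> N" "0 \<le> m" shows "ky (G * sg m 1) \<subseteq> N"
  using keys_mult[of G "sg m 1"] assms N_up by auto

lemma deriv_coeffs:
  fixes F :: "'k sym laurent"
  assumes "F \<in> coeffs_in (Sym (vspan N))" shows "laurent_deriv F \<in> coeffs_in (Sym (vspan N))"
  using assms by (auto simp: coeffs_in_def lookup_laurent_deriv simp del: of_int_add intro!: mult_A of_int_A)

lemma bracket_coeffs:
  fixes F G :: "'k sym laurent"
  assumes "F \<in> coeffs_in (Sym (vspan N))" "G \<in> coeffs_in (Sym (vspan N))"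
  shows "witt_bracket F G \<in> coeffs_in (Sym (vspan N))"
proof -
  interpret B: prime_of_subring "coeffs_in (Sym (vspan N)) :: 'k sym laurent set" "coeffs_in Q"
    by (rule prime_of_subring_coeffs_in)
  show ?thesis
    unfolding witt_bracket_def by (intro B.diff_A B.mult_A deriv_coeffs assms)
qed

lemma bracket_keys:
  fixes F G :: "'k sym laurent"
  assumes "ky F \<subseteq> N" "ky G \<subseteq> N" shows "ky (witt_bracket F G) \<subseteq> N"
proof -
  have "vspan N \<in> {Witt, Witt_ge_m1, Witt_ge_1 :: 'k sym laurent set}"
    using N by (auto simp: exponent_set_def Witt_def Witt_ge_m1_def Witt_ge_1_def)
  from witt_bracket_closed[OF this, of F G] show ?thesis using assms by auto
qed

lemma pairing_Sym:
  fixes F :: "'k sym laurent"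
  assumes "F \<in> coeffs_in (Sym (vspan N))" "ky F \<subseteq> N"
  shows "generic_pairing F \<in> Sym (vspan N)"
  unfolding generic_pairing_def using assms
  by (intro sum_A mult_A sym_var_Sym) (auto simp: coeffs_in_def)

text \<open>
  Two stabilizing vector fields \<open>U\<close>, \<open>V\<close> give a linear recurrence with constant coefficients:
  the generic point kills $[U, Vh]$ and $[V, Uh]$, hence $2[U,V]h$, for $h = t^m$.  Only
  $m \ge 0$ keeps $Vh$ and $Uh$ inside the algebra in each of the three cases.
\<close>

lemma pairing_mem:
  assumes p: "p \<in> Q" and q: "q \<in> Q" and m: "0 \<le> m"
  shows "generic_pairing (witt_bracket (differential p) (differential q) * sg m 1) \<in> Q"
proof -
  interpret B: prime_of_subring "coeffs_in (Sym (vspan N)) :: 'k sym laurent set" "coeffs_in Q"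
    by (rule prime_of_subring_coeffs_in)
  let ?U = "differential p" and ?V = "differential q" and ?h = "sg m (1 :: 'k sym)"
  have hA: "?h \<in> coeffs_in (Sym (vspan N))" by (rule single_coeffs_in) (rule one_A)
  have "generic_pairing (witt_bracket ?U (?V * ?h)) \<in> Q" "generic_pairing (witt_bracket ?V (?U * ?h)) \<in> Q"
    by (intro pairing_bracket_mem B.mult_A differential_coeffs hA keys_mult_power differential_keys assms)+
  moreover have "generic_pairing (witt_bracket ?U (?V * ?h)) =
      generic_pairing (witt_bracket ?V (?U * ?h)) + generic_pairing (sg 0 2 * (witt_bracket ?U ?V * ?h))"
  proof -
    have "sg 0 2 = (2 :: 'k sym laurent)" by (metis one_add_one single_add single_one)
    then have "witt_bracket ?U (?V * ?h) = witt_bracket ?V (?U * ?h) + sg 0 2 * (witt_bracket ?U ?V * ?h)"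
      using witt_bracket_double[of ?U ?V ?h] by (simp add: algebra_simps)
    then show ?thesis by (simp only: generic_pairing_add)
  qed
  ultimately have "of_int 2 * generic_pairing (witt_bracket ?U ?V * ?h) \<in> Q"
    unfolding generic_pairing_scale using add_Q_cancel by (simp add: add.commute)
  moreover have "generic_pairing (witt_bracket ?U ?V * ?h) \<in> Sym (vspan N)"
    by (intro pairing_Sym keys_mult_power m bracket_keys differential_keys B.mult_A hA
        bracket_coeffs differential_coeffs p q)
  ultimately show ?thesis using of_int_cancel[of _ 2] by (metis zero_neq_numeral)
qed

text \<open>
  The recurrence of \<open>pairing_mem\<close> is nontrivial for suitable \<open>p\<close> and \<open>q\<close>.
  Let \<open>M\<close> be the top index with $\partial p/\partial e_M \notin Q$.  For large \<open>J\<close> the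
  differential of $q = \{p, e_J\}$ reaches beyond the one of \<open>p\<close>, with top coefficient a
  multiple of $\partial p/\partial e_M$, so that the bracket of the two differentials has a
  leading coefficient outside \<open>Q\<close>.
\<close>

lemma ex_recurrence:
  assumes "Q \<noteq> {0}"
  obtains w k where "w \<in> coeffs_in (Sym (vspan N))" "ky w \<subseteq> N" "lk w k \<notin> Q"
    "\<forall>m\<ge>0. generic_pairing (w * sg m 1) \<in> Q"
proof -
  obtain p i where p: "p \<in> Q" and i: "sym_pderiv i p \<notin> Q"
    using ex_sym_pderiv_notin[OF prime assms] .
  let ?V = "sym_vars p"
  let ?X = "{i \<in> ?V. sym_pderiv i p \<notin> Q}"
  have iX: "i \<in> ?X" using i sym_pderiv_notin[of i p] zero_Q by force
  define M where "M = Max ?X"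
  have M: "M \<in> ?V" "sym_pderiv M p \<notin> Q" using Max_in[of ?X] iX by (auto simp: M_def)
  have above: "sym_pderiv l p \<in> Q" if "M < l" for l
  proof (rule ccontr)
    assume l: "sym_pderiv l p \<notin> Q"
    then have "l \<in> ?X" using sym_pderiv_notin[of l p] zero_Q by force
    then have "l \<le> M" unfolding M_def by (intro Max_ge) auto
    then show False using that by simp
  qed
  define b where "b = Max ?V"
  have b: "l \<le> b" if "l \<in> ?V" for l using that by (simp add: b_def)
  \<comment> \<open>Large enough that $J \in N$, $J \ne M$ and that $M + J - 1$ lies above all variables of \<open>p\<close>.\<close>
  define J where "J = 3 + 2 * \<bar>b\<bar> + \<bar>M\<bar>"
  have JN: "J \<in> N" using N by (auto simp: exponent_set_def J_def)
  have J: "J > M" "J > 1" "M + J - 1 > b" using b[OF M(1)] by (auto simp: J_def)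
  define q where "q = poisson p (sym_var J)"
  have q: "q \<in> Q" unfolding q_def by (rule bracket[OF p JN])
  let ?u = "sym_pderiv M p"
  have dq: "sym_pderiv l q = sym_const (of_int (J - (l - J + 1))) * sym_pderiv (l - J + 1) p" if "l > b" for l
    unfolding q_def using b that by (intro sym_pderiv_poisson_var) force
  have topq: "sym_pderiv (M + J - 1) q = of_int (J - M) * ?u"
    using dq[OF J(3)] by (simp add: sym_const_of_int del: of_int_diff)
  have aboveq: "sym_pderiv l q \<in> Q" if "l > M + J - 1" for l
    using that J(3) by (subst dq) (auto intro!: mult_Q Sym.const above)
  let ?P = "differential p" and ?R = "differential q"
  let ?w = "witt_bracket ?P ?R"
  let ?K = "M + (M + J - 2)"
  have cs: "?P \<in> coeffs_in (Sym (vspan N))" "?R \<in> coeffs_in (Sym (vspan N))"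
    using p q by (auto intro: differential_coeffs)
  have A: "?u \<in> Sym (vspan N)" using p Q_subset by (auto intro: sym_pderiv_Sym)
  \<comment> \<open>The two halves $UV'$ and $U'V$ of the bracket have their leading terms in the same degree;
    the difference of the leading coefficients is $(M + J - 1) - M = J - 1$ times
    $(J - M)(\partial p/\partial e_M)^2$.\<close>
  have 1: "lk (?P * laurent_deriv ?R) (M + (M + J - 2)) - lk ?P M * lk (laurent_deriv ?R) (M + J - 2) \<in> Q"
    by (rule lookup_mult_leading[OF cs(1) deriv_coeffs[OF cs(2)]])
       (auto simp del: of_int_add simp: lookup_differential lookup_laurent_deriv above intro!: mult_Q of_int_A aboveq)
  have 2: "lk (laurent_deriv ?P * ?R) ((M - 1) + (M + J - 1)) - lk (laurent_deriv ?P) (M - 1) * lk ?R (M + J - 1) \<in> Q"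
    by (rule lookup_mult_leading[OF deriv_coeffs[OF cs(1)] cs(2)])
       (auto simp del: of_int_add simp: lookup_differential lookup_laurent_deriv aboveq intro!: mult_Q of_int_A above)
  have e: "(M - 1) + (M + J - 1) = ?K" "M + J - 2 + 1 = M + J - 1" "M - 1 + 1 = M" by simp_all
  have "lk ?w ?K - (lk ?P M * lk (laurent_deriv ?R) (M + J - 2) - lk (laurent_deriv ?P) (M - 1) * lk ?R (M + J - 1)) \<in> Q"
    using diff_Q[OF 1 2] unfolding e by (simp add: witt_bracket_def lookup_minus algebra_simps)
  also have "lk ?P M * lk (laurent_deriv ?R) (M + J - 2) - lk (laurent_deriv ?P) (M - 1) * lk ?R (M + J - 1)
      = of_int ((J - 1) * (J - M)) * (?u * ?u)"
    by (simp only: lookup_differential lookup_laurent_deriv e topq) (simp add: algebra_simps)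
  finally have top: "lk ?w ?K - of_int ((J - 1) * (J - M)) * (?u * ?u) \<in> Q" .
  have "lk ?w ?K \<notin> Q"
  proof
    assume "lk ?w ?K \<in> Q"
    from diff_Q[OF this top] have "of_int ((J - 1) * (J - M)) * (?u * ?u) \<in> Q" by simp
    moreover have "(J - 1) * (J - M) \<noteq> 0" using J by auto
    ultimately have "?u * ?u \<in> Q" by (rule of_int_cancel[OF mult_A[OF A A]])
    then show False using prime_Q[OF A A] M(2) by blast
  qed
  moreover have "\<forall>m\<ge>0. generic_pairing (?w * sg m 1) \<in> Q" using pairing_mem[OF p q] by simp
  ultimately show ?thesis
    by (rule that[OF bracket_coeffs[OF cs] bracket_keys[OF differential_keys[OF p] differential_keys[OF q]]])
qed

end


section \<open>Evaluation homomorphisms and the generic Hankel determinant\<close>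

lemma Sym_vspan_UNIV: "p \<in> Sym (vspan UNIV)"
proof (induction p rule: pm_induct)
  case (single m c)
  have "sg m (1::'a) \<in> Sym (vspan UNIV)" for m :: "int \<Rightarrow>\<^sub>0 nat"
  proof (induction m rule: pm_induct)
    case (single i n)
    show ?case
    proof (induction n)
      case (Suc n)
      have "sg (sg i (Suc n)) (1::'a) = sym_emb (sg i 1) * sg (sg i n) 1"
        by (simp add: mult_single single_add[symmetric])
      then show ?case using Sym.mult[OF Sym.emb Suc, of "sg i 1"] by simp
    qed (simp add: one_Sym)
  next
    case (add m n)
    then show ?case using Sym.mult[of "sg m 1" _ "sg n 1"] by (simp add: mult_single)
  qed
  from Sym.mult[OF Sym.const[of c] this[of m]] show ?case
    by (simp add: sym_const_def mult_single)
qed (rule Sym.add)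

lemma ex_sym_hom:
  fixes \<phi> :: "'k::comm_ring_1 \<Rightarrow> 'A::comm_ring_1" and x :: "int \<Rightarrow> 'A"
  assumes \<phi>: "\<phi> 1 = 1" "\<And>a b. \<phi> (a + b) = \<phi> a + \<phi> b" "\<And>a b. \<phi> (a * b) = \<phi> a * \<phi> b"
  obtains F where "comm_ring_hom F" "\<And>c. F (sym_const c) = \<phi> c" "\<And>i. F (sym_var i) = x i"
proof -
  have \<phi>0: "\<phi> 0 = 0" using \<phi>(2)[of 0 0] by simp
  define f where "f u = (\<Sum>n\<in>ky u. \<phi> (lk u n) * x n)" for u :: "'k laurent"
  have f_add: "f (u + v) = f u + f v" for u v
    unfolding f_def by (rule sum_keys_add) (simp_all add: \<phi> \<phi>0 algebra_simps)
  have f_single: "f (sg n c) = \<phi> c * x n" for n c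
    by (cases "c = 0") (simp_all add: f_def \<phi>0)
  have f_scale: "f (sg 0 c * u) = \<phi> c * f u" for c u
    by (induction u rule: pm_induct) (simp_all add: f_add f_single mult_single \<phi> algebra_simps)
  obtain F where F: "\<forall>c. F (sym_const c) = \<phi> c" "\<forall>u\<in>vspan UNIV. F (sym_emb u) = f u"
    "\<forall>p\<in>Sym (vspan UNIV). \<forall>q\<in>Sym (vspan UNIV). F (p + q) = F p + F q \<and> F (p * q) = F p * F q"
    using Sym_universal[of \<phi> UNIV f, OF \<phi> f_add f_scale] by auto
  show ?thesis
  proof (rule that)
    have 0: "F 0 = 0" "F 1 = 1"
      using F(1)[rule_format, of 0] F(1)[rule_format, of 1] by (simp_all add: sym_const_simps \<phi> \<phi>0)
    show "comm_ring_hom F"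
      by unfold_locales (use 0 F(3) Sym_vspan_UNIV in auto)
    show "F (sym_const c) = \<phi> c" for c using F(1) by blast
    show "F (sym_var i) = x i" for i
      using F(2) f_single[of i 1] by (simp add: sym_var_def \<phi> del: sym_emb_single)
  qed
qed

definition hankel :: "int \<Rightarrow> nat \<Rightarrow> 'k::comm_ring_1 sym mat" where
  "hankel s n = mat n n (\<lambda>(i, j). sym_var (s + int i + int j))"

text \<open>
  Sending one variable to $1$ and the others to $0$ makes the matrix anti-diagonal.
\<close>

lemma det_hankel_nonzero: "det (hankel s n) \<noteq> (0 :: 'k::field sym)"
proof
  assume det0: "det (hankel s n) = (0 :: 'k sym)"
  obtain F :: "'k sym \<Rightarrow> 'k" where F: "comm_ring_hom F"
    "\<And>i. F (sym_var i) = (if i = s + int n - 1 then 1 else 0)"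
    using ex_sym_hom[of "\<lambda>c. c" "\<lambda>i. if i = s + int n - 1 then 1 else 0"] by (metis (lifting))
  interpret F: comm_ring_hom F by (rule F)
  define H where "H = map_mat F (hankel s n)"
  have H: "H \<in> carrier_mat n n" by (auto simp: H_def hankel_def)
  have "det H = 0" unfolding H_def F.hom_det det0 by simp
  then obtain v where v: "v \<in> carrier_vec n" "v \<noteq> 0\<^sub>v n" "H *\<^sub>v v = 0\<^sub>v n"
    using det_0_iff_vec_prod_zero[OF H] by blast
  have "v $ j = 0" if j: "j < n" for j
  proof -
    let ?i = "n - 1 - j"
    have "0 = (H *\<^sub>v v) $ ?i" using v(3) j by simp
    also have "\<dots> = (\<Sum>k\<in>{0..<n}. H $$ (?i, k) * v $ k)"
      using H v(1) j by (simp add: scalar_prod_def)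
    also have "\<dots> = (\<Sum>k\<in>{0..<n}. if k = j then v $ k else 0)"
    proof (intro sum.cong refl)
      fix k assume "k \<in> {0..<n}"
      moreover have "s + int ?i + int k = s + int n - 1 \<longleftrightarrow> k = j" using j by auto
      ultimately show "H $$ (?i, k) * v $ k = (if k = j then v $ k else 0)"
        using j by (simp add: H_def hankel_def F(2))
    qed
    also have "\<dots> = v $ j" using j by simp
    finally show ?thesis by simp
  qed
  then have "v = 0\<^sub>v n" using v(1) by auto
  with v(2) show False by contradiction
qed

section \<open>Adding a point to a prime Poisson ideal\<close>

text \<open>
  Laurent polynomials in two variables \<open>x\<close> and \<open>y\<close> over the symmetric algebra.  The
  coordinates of an exponent are indexed by \<open>False\<close> (for \<open>x\<close>) and \<open>True\<close> (for \<open>y\<close>): exponents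
  of this kind form a linearly ordered group, as \<open>prime_of_subring_coeffs_in\<close> requires.
\<close>

type_synonym 'k point_sym = "(bool \<Rightarrow>\<^sub>0 int) \<Rightarrow>\<^sub>0 'k sym"

definition xy :: "int \<Rightarrow> int \<Rightarrow> (bool \<Rightarrow>\<^sub>0 int)" where
  "xy a b = sg False a + sg True b"

lemma xy_simps: "xy a b + xy c d = xy (a + c) (b + d)" "xy 0 0 = 0"
  "lk (xy a b) False = a" "lk (xy a b) True = b"
  by (simp_all add: xy_def single_add lookup_add lookup_single algebra_simps)

lemma xy_eq_iff: "xy a b = xy c d \<longleftrightarrow> a = c \<and> b = d"
  by (metis xy_simps(3,4))

text \<open>
  The derivation $\{\cdot, e_j\} - x^j\,\partial_x + j x^{j-1} y\,\partial_y$.  The part in \<open>x\<close> and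
  \<open>y\<close> is the action of $t^j\partial$ on the cotangent bundle of the line, for which
  $y x^i \mapsto (j - i)\,y x^{i+j-1}$, exactly as $\{e_i, e_j\} = (j - i)\,e_{i+j-1}$.
\<close>

definition point_deriv :: "int \<Rightarrow> 'k::comm_ring_1 point_sym \<Rightarrow> 'k point_sym" where
  "point_deriv j F = (\<Sum>m\<in>ky F. sg m (poisson (lk F m) (sym_var j)) +
     sg (m + xy (j - 1) 0) (sym_const (of_int (j * lk m True - lk m False)) * lk F m))"

lemma poisson_zero: "poisson 0 q = 0"
  using poisson_const[of 0 q] by (simp add: sym_const_simps)

lemma point_deriv_single:
  "point_deriv j (sg m p) = sg m (poisson p (sym_var j)) +
     sg (m + xy (j - 1) 0) (sym_const (of_int (j * lk m True - lk m False)) * p)"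
  by (cases "p = 0") (simp_all add: point_deriv_def poisson_zero)

lemma point_deriv_add: "point_deriv j (F + G) = point_deriv j F + point_deriv j G"
  unfolding point_deriv_def
  by (rule sum_keys_add) (simp_all add: poisson_zero poisson_add_left single_add algebra_simps)

lemma point_deriv_mult: "point_deriv j (F * G) = point_deriv j F * G + F * point_deriv j G"
proof (induction F rule: pm_induct)
  case (single m p)
  show ?case
  proof (induction G rule: pm_induct)
    case (single n q)
    let ?c = "\<lambda>m. sym_const (of_int (j * lk m True - lk m False)) :: 'a sym"
    have c: "?c (m + n) = ?c m + ?c n"
      by (simp add: lookup_add algebra_simps flip: sym_const_simps(3))
    have e: "m + xy (j - 1) 0 + n = m + n + xy (j - 1) 0" "m + (n + xy (j - 1) 0) = m + n + xy (j - 1) 0"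
      by (simp_all add: algebra_simps)
    show ?case
      by (simp only: mult_single point_deriv_single distrib_left distrib_right e)
         (simp only: c poisson_mult_left single_add[symmetric] distrib_right mult_ac add_ac, simp add: single_add algebra_simps)
  qed (simp add: point_deriv_add algebra_simps)
qed (simp add: point_deriv_add algebra_simps)


text \<open>
  On points of the dual, \<open>T\<close> adds to a functional \<open>\<chi>\<close> the evaluation $f\partial \mapsto y f(x)$ at
  a point \<open>x\<close> with weight \<open>y\<close>.
\<close>

locale point_substitution =
  fixes T :: "'k::field_char_0 sym \<Rightarrow> 'k point_sym"
  assumes hom: "comm_ring_hom T"
    and T_const: "T (sym_const c) = sg 0 (sym_const c)"
    and T_var: "T (sym_var i) = sg 0 (sym_var i) + sg (xy i 1) 1"

sublocale point_substitution \<subseteq> T: comm_ring_hom T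
  by (rule hom)

lemma ex_point_substitution: "\<exists>T :: 'k::field_char_0 sym \<Rightarrow> 'k point_sym. point_substitution T"
proof -
  obtain T :: "'k sym \<Rightarrow> 'k point_sym" where "comm_ring_hom T"
    "\<And>c. T (sym_const c) = sg 0 (sym_const c)"
    "\<And>i. T (sym_var i) = sg 0 (sym_var i) + sg (xy i 1) 1"
    by (rule ex_sym_hom[of "\<lambda>c. sg 0 (sym_const c)" "\<lambda>i. sg 0 (sym_var i) + sg (xy i 1) 1"])
       (auto simp: sym_const_simps single_add mult_single)
  then show ?thesis by (auto simp: point_substitution_def intro: exI[of _ T])
qed

lemma sym_induct [case_names const var add mult]:
  fixes p :: "'k::comm_ring_1 sym"
  assumes c: "\<And>c. P (sym_const c)" and v: "\<And>i. P (sym_var i)"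
    and a: "\<And>p q. P p \<Longrightarrow> P q \<Longrightarrow> P (p + q)" and m: "\<And>p q. P p \<Longrightarrow> P q \<Longrightarrow> P (p * q)"
  shows "P p"
proof -
  have e: "P (sym_emb u)" for u
    by (induction u rule: pm_induct)
       (auto simp: sym_emb_var sym_emb_add intro: c v a m simp del: sym_emb_single)
  show ?thesis
    using Sym_vspan_UNIV[of p] by induction (auto intro: c e a m)
qed

context point_substitution
begin

text \<open>
  Both sides obey the Leibniz rule along \<open>T\<close>, so that the variables decide; there the
  coefficients of \<open>point_deriv\<close> are chosen to match.
\<close>

lemma T_poisson: "T (poisson p (sym_var j)) = point_deriv j (T p)"
proof (induction p rule: sym_induct)
  case (const c)
  then show ?case by (simp add: poisson_const T_const point_deriv_single xy_simps sym_const_simps)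
next
  case (var i)
  have "poisson (sym_var i) (sym_var j :: 'k sym) = sym_const (of_int (j - i)) * sym_var (i + j - 1)"
    unfolding sym_var_def[of i] sym_var_def[of j] poisson_emb witt_bracket_single
    by (simp add: sym_emb_var del: sym_emb_single)
  moreover have "poisson 1 (sym_var j :: 'k sym) = 0"
    using poisson_const[of 1 "sym_var j"] by (simp add: sym_const_simps)
  moreover have "i + (j - 1) = i + j - 1" by simp
  ultimately show ?case
    by (simp only: T.hom_mult T_const T_var point_deriv_add point_deriv_single xy_simps)
       (simp add: mult_single distrib_left sym_const_simps)
next
  case (add p q)
  then show ?case by (simp add: poisson_add_left T.hom_add point_deriv_add)
next
  case (mult p q)
  then show ?case by (simp add: poisson_mult_left T.hom_add T.hom_mult point_deriv_mult)
qed

text \<open>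
  Since negative powers of \<open>y\<close> exist in the ring, setting $y = 0$ makes no sense there; the
  filtration by powers of \<open>y\<close> replaces it.
\<close>

definition order_ge :: "int \<Rightarrow> 'k point_sym set" where
  "order_ge k = {F. \<forall>m\<in>ky F. k \<le> lk m True}"

lemma order_ge_add: "F \<in> order_ge k \<Longrightarrow> G \<in> order_ge k \<Longrightarrow> F + G \<in> order_ge k"
  using keys_add[of F G] by (auto simp: order_ge_def)

lemma order_ge_sum: "(\<And>i. i \<in> X \<Longrightarrow> f i \<in> order_ge k) \<Longrightarrow> sum f X \<in> order_ge k"
proof (induction X rule: infinite_finite_induct)
  case (insert x X)
  then show ?case by (simp add: order_ge_add)
qed (simp_all add: order_ge_def)

lemma order_ge_mult: "F \<in> order_ge k \<Longrightarrow> G \<in> order_ge l \<Longrightarrow> F * G \<in> order_ge (k + l)"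
  using keys_mult[of F G] by (force simp: order_ge_def lookup_add intro: add_mono)

lemma order_ge_single: "k \<le> lk m True \<Longrightarrow> sg m c \<in> order_ge k"
  by (auto simp: order_ge_def)

lemma order_ge_mono: "F \<in> order_ge k \<Longrightarrow> l \<le> k \<Longrightarrow> F \<in> order_ge l"
  by (force simp: order_ge_def)

definition linear_part :: "'k sym \<Rightarrow> 'k point_sym" where
  "linear_part p = (\<Sum>i\<in>sym_vars p. sg (xy i 1) (sym_pderiv i p))"

lemma linear_part_eq:
  assumes "finite X" "sym_vars p \<subseteq> X"
  shows "linear_part p = (\<Sum>i\<in>X. sg (xy i 1) (sym_pderiv i p))"
  unfolding linear_part_def using assms
  by (intro sum.mono_neutral_left) (auto simp: sym_pderiv_notin)

lemma linear_part_order: "linear_part p \<in> order_ge 1"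
  unfolding linear_part_def by (intro order_ge_sum order_ge_single) (simp add: xy_simps)

lemma linear_part_add: "linear_part (p + q) = linear_part p + linear_part q"
proof -
  define X where "X = sym_vars p \<union> sym_vars q \<union> sym_vars (p + q)"
  have X: "finite X" "sym_vars p \<subseteq> X" "sym_vars q \<subseteq> X" "sym_vars (p + q) \<subseteq> X"
    by (auto simp: X_def)
  show ?thesis
    unfolding linear_part_eq[OF X(1,2)] linear_part_eq[OF X(1,3)] linear_part_eq[OF X(1,4)]
    by (simp add: sym_pderiv_add single_add sum.distrib)
qed

lemma linear_part_mult: "linear_part (p * q) = linear_part p * sg 0 q + sg 0 p * linear_part q"
proof -
  define X where "X = sym_vars p \<union> sym_vars q \<union> sym_vars (p * q)"
  have X: "finite X" "sym_vars p \<subseteq> X" "sym_vars q \<subseteq> X" "sym_vars (p * q) \<subseteq> X"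
    by (auto simp: X_def)
  show ?thesis
    unfolding linear_part_eq[OF X(1,2)] linear_part_eq[OF X(1,3)] linear_part_eq[OF X(1,4)]
    by (simp add: sym_pderiv_mult single_add sum.distrib sum_distrib_left sum_distrib_right mult_single)
qed

text \<open>
  Taylor expansion of the substitution to first order in \<open>y\<close>.
\<close>

lemma T_taylor: "T p - sg 0 p - linear_part p \<in> order_ge 2"
proof (induction p rule: sym_induct)
  case (const c)
  have "sym_vars (sym_const c :: 'k sym) = {}" by (auto simp: sym_vars_def sym_const_def)
  then show ?case by (simp add: T_const linear_part_def order_ge_def)
next
  case (var i)
  have "sym_vars (sym_var i :: 'k sym) = {i}" by (auto simp: sym_vars_def sym_var_def)
  then show ?case by (simp add: T_var linear_part_def order_ge_def sym_pderiv_var)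
next
  case (add p q)
  have "T (p + q) - sg 0 (p + q) - linear_part (p + q) =
      (T p - sg 0 p - linear_part p) + (T q - sg 0 q - linear_part q)"
    by (simp add: T.hom_add single_add linear_part_add)
  then show ?case using order_ge_add[OF add] by simp
next
  case (mult p q)
  define r where "r = T p - sg 0 p - linear_part p"
  define s where "s = T q - sg 0 q - linear_part q"
  have r: "r \<in> order_ge 2" and s: "s \<in> order_ge 2" using mult by (simp_all add: r_def s_def)
  have Tp: "T p = sg 0 p + linear_part p + r" and Tq: "T q = sg 0 q + linear_part q + s"
    by (simp_all add: r_def s_def)
  have c: "sg 0 a \<in> order_ge 0" for a by (simp add: order_ge_def)
  have "T (p * q) - sg 0 (p * q) - linear_part (p * q) =
      linear_part p * linear_part q + r * (sg 0 q + linear_part q + s) + (sg 0 p + linear_part p) * s"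
    by (simp add: T.hom_mult Tp Tq linear_part_mult mult_single[of 0 p 0 q, simplified, symmetric] algebra_simps)
  also have "\<dots> \<in> order_ge 2"
  proof (intro order_ge_add)
    have l: "linear_part a \<in> order_ge 0" for a by (rule order_ge_mono[OF linear_part_order]) simp
    have s0: "s \<in> order_ge 0" by (rule order_ge_mono[OF s]) simp
    show "linear_part p * linear_part q \<in> order_ge 2"
      using order_ge_mult[OF linear_part_order linear_part_order, of p q] by simp
    show "r * (sg 0 q + linear_part q + s) \<in> order_ge 2"
      using order_ge_mult[OF r order_ge_add[OF order_ge_add[OF c l] s0]] by simp
    show "(sg 0 p + linear_part p) * s \<in> order_ge 2"
      using order_ge_mult[OF order_ge_add[OF c l] s] by simp
  qed
  finally show ?case .
qed

lemma lookup_T_0: "lk (T p) 0 = p"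
  and lookup_T_1: "lk (T p) (xy i 1) = sym_pderiv i p"
proof -
  have z: "lk (T p - sg 0 p - linear_part p) m = 0" if "lk m True < 2" for m
    using T_taylor[of p] that by (force simp: order_ge_def in_keys_iff)
  have "lk (linear_part p) 0 = 0"
    by (simp add: linear_part_def lookup_sum lookup_single when_def xy_eq_iff flip: xy_simps(2))
  then show "lk (T p) 0 = p" using z[of 0] by (simp add: lookup_minus)
  have "lk (linear_part p) (xy i 1) = sym_pderiv i p"
    by (auto simp: linear_part_def lookup_sum lookup_single when_def xy_eq_iff sym_pderiv_notin)
  moreover have "lk (sg 0 p) (xy i 1) = 0"
    by (simp add: lookup_single when_def xy_eq_iff flip: xy_simps(2))
  ultimately show "lk (T p) (xy i 1) = sym_pderiv i p"
    using z[of "xy i 1"] by (simp add: lookup_minus xy_simps)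
qed

end


locale witt_prime_substitution = witt_prime N Q + point_substitution T
  for N :: "int set" and Q :: "'k::field_char_0 sym set" and T :: "'k sym \<Rightarrow> 'k point_sym"

sublocale witt_prime_substitution \<subseteq>
  B: prime_of_subring "coeffs_in (Sym (vspan N)) :: 'k point_sym set" "coeffs_in Q"
  by (rule prime_of_subring_coeffs_in)

context witt_prime_substitution
begin

lemma T_coeffs: "p \<in> Sym (vspan N) \<Longrightarrow> T p \<in> coeffs_in (Sym (vspan N))"
proof (induction rule: Sym.induct)
  case (const c)
  show ?case unfolding T_const by (rule single_coeffs_in(1)[OF Sym.const])
next
  case (emb u)
  have "sym_emb (\<Sum>i\<in>X. sg i (lk u i)) = (\<Sum>i\<in>X. sym_const (lk u i) * sym_var i)" if "finite X" for X
    using that by induction (simp_all add: sym_emb_add sym_emb_var del: sym_emb_single)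
  from this[OF finite_keys[of u]] have "sym_emb u = (\<Sum>i\<in>ky u. sym_const (lk u i) * sym_var i)"
    by (simp only: pm_expand[symmetric])
  then show ?case
    using emb by (auto simp: T.hom_sum T.hom_mult T_const T_var
      intro!: B.sum_A B.mult_A B.add_A single_coeffs_in(1) Sym.const sym_var_Sym one_A)
qed (auto simp: T.hom_add T.hom_mult intro: B.add_A B.mult_A)

text \<open>
  The functions that vanish on the sum of the zero set of \<open>Q\<close> and the family of all weighted
  point evaluations.
\<close>

definition point_prime :: "'k sym set" where
  "point_prime = {p \<in> Sym (vspan N). T p \<in> coeffs_in Q}"

text \<open>
  Points of weight $y = 0$ recover the zero set of \<open>Q\<close>.
\<close>

lemma point_prime_subset: "point_prime \<subseteq> Q"
  using lookup_T_0 by (auto simp: point_prime_def dest: coeffs_inD[of _ _ 0])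

lemma point_prime_witt_prime: "witt_prime N point_prime"
proof (unfold_locales)
  show "exponent_set N" by (rule N)
next
  fix p j assume p: "p \<in> point_prime" and j: "j \<in> N"
  have "poisson p (sym_var j) \<in> Q" using p j point_prime_subset bracket by blast
  then have 1: "poisson p (sym_var j) \<in> Sym (vspan N)" using Q_subset by blast
  have Tp: "lk (T p) m \<in> Q" for m using p by (auto simp: point_prime_def coeffs_in_def)
  have "T (poisson p (sym_var j)) \<in> coeffs_in Q"
    unfolding T_poisson point_deriv_def
    by (intro B.sum_Q B.add_Q single_coeffs_in(2) bracket mult_Q Sym.const Tp j)
  with 1 show "poisson p (sym_var j) \<in> point_prime" by (simp add: point_prime_def)
qed (use one_A zero_A in \<open>auto simp: point_prime_def T.hom_add T.hom_mult B.one_notin_Q B.zero_Q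
    intro: add_A mult_A uminus_A B.add_Q B.mult_Q T_coeffs dest: B.prime_Q[OF T_coeffs T_coeffs]\<close>)

text \<open>
  The coefficients of \<open>y\<close> in \<open>T p\<close> are the partial derivatives of \<open>p\<close>, and \<open>Q\<close> is not stable
  under these.
\<close>

lemma point_prime_strict:
  assumes "Q \<noteq> {0}" shows "point_prime \<subset> Q"
proof -
  obtain p i where p: "p \<in> Q" "sym_pderiv i p \<notin> Q"
    using ex_sym_pderiv_notin[OF prime assms] .
  then have "p \<notin> point_prime"
    using lookup_T_1[of p i] by (auto simp: point_prime_def dest: coeffs_inD[of _ _ "xy i 1"])
  then show ?thesis using p(1) point_prime_subset by blast
qed

text \<open>
  Modulo \<open>Q\<close> the generic point satisfies a linear recurrence with coefficients \<open>w\<close>; after a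
  point at \<open>x\<close> has been added, it satisfies the one with coefficients $(t - x)\,w$.  These
  coefficients lie in the kernel of a Hankel matrix of the new functional, so that its
  determinant vanishes.
\<close>

lemma point_prime_nonzero:
  assumes "Q \<noteq> {0}" shows "point_prime \<noteq> {0}"
proof -
  obtain w k where w: "w \<in> coeffs_in (Sym (vspan N))" "ky w \<subseteq> N" "lk w k \<notin> Q"
    and rec: "\<forall>m\<ge>0. generic_pairing (w * sg m 1) \<in> Q"
    using ex_recurrence[OF assms] .
  have k: "k \<in> ky w" using w(3) zero_Q by (auto simp: in_keys_iff)
  define s where "s = Min (ky w)"
  define n where "n = nat (Max (ky w) - s)"
  have "s \<in> ky w" unfolding s_def using k by (intro Min_in) auto
  then have s: "s \<in> N" using w(2) by blast
  have range: "s \<le> i \<and> i \<le> s + int n" if "i \<in> ky w" for i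
  proof -
    have "s \<le> i" "i \<le> Max (ky w)" using that by (auto simp: s_def)
    then show ?thesis by (simp add: n_def)
  qed
  have rec': "(\<Sum>j\<le>n. sym_var (s + int i + int j) * lk w (s + int j)) \<in> Q" for i
  proof -
    have "w * sg (int i) 1 = (\<Sum>l\<in>ky w. sg l (lk w l)) * sg (int i) 1"
      by (simp only: pm_expand[symmetric])
    then have "generic_pairing (w * sg (int i) 1) = (\<Sum>l\<in>ky w. lk w l * sym_var (l + int i))"
      by (simp add: sum_distrib_right mult_single generic_pairing_sum)
    also have "\<dots> = (\<Sum>l\<in>(\<lambda>j. s + int j) ` {..n}. lk w l * sym_var (l + int i))"
    proof (rule sum.mono_neutral_left)
      show "ky w \<subseteq> (\<lambda>j. s + int j) ` {..n}"
      proof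
        fix l assume "l \<in> ky w"
        with range[of l] show "l \<in> (\<lambda>j. s + int j) ` {..n}"
          by (intro image_eqI[of _ _ "nat (l - s)"]) auto
      qed
    qed (auto simp: in_keys_iff)
    also have "\<dots> = (\<Sum>j\<le>n. sym_var (s + int i + int j) * lk w (s + int j))"
      by (subst sum.reindex) (auto simp: inj_on_def algebra_simps)
    finally show ?thesis using rec[rule_format, of "int i"] by simp
  qed
  let ?x = "sg (xy 1 0) 1 :: 'k point_sym"
  let ?W = "\<lambda>i. sg 0 (lk w i) :: 'k point_sym"
  \<comment> \<open>The coefficients of $(t - x)\,w$, where \<open>z j\<close> belongs to $t^{s+j}$.\<close>
  define z where "z j = ?W (s + int j - 1) - ?x * ?W (s + int j)" for j
  define H :: "'k sym mat" where "H = hankel s (n + 2)"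
  define M where "M = map_mat T H"
  have H: "H \<in> carrier_mat (n + 2) (n + 2)" and M: "M \<in> carrier_mat (n + 2) (n + 2)"
    by (auto simp: H_def M_def hankel_def)
  have He: "H $$ (i, j) = sym_var (s + int i + int j)" if "i < n + 2" "j < n + 2" for i j
    using that by (simp add: H_def hankel_def)
  have Me: "M $$ (i, j) = T (sym_var (s + int i + int j))" if "i < n + 2" "j < n + 2" for i j
    using that H by (simp add: M_def He)
  have var: "sym_var (s + int i + int j) \<in> Sym (vspan N)" for i j
    using sym_var_Sym[OF N_up[OF s, of "int i + int j"]] by (simp add: add.assoc)
  have W: "?W i \<in> coeffs_in (Sym (vspan N))" for i
    using w(1) by (intro single_coeffs_in) (rule coeffs_inD)
  have x: "?x \<in> coeffs_in (Sym (vspan N))" by (rule single_coeffs_in(1)[OF one_A])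
  have "lk w i = 0" if "i < s \<or> s + int n < i" for i
    using range[of i] that by (cases "i \<in> ky w") (auto simp: in_keys_iff)
  then have ends: "?W (s - 1) = 0" "?W (s + int n + 1) = 0" by simp_all
  have "det M \<in> coeffs_in Q"
  proof (rule B.det_in_prime[OF M])
    show "M $$ (i, j) \<in> coeffs_in (Sym (vspan N))" if "i < n + 2" "j < n + 2" for i j
      using that by (simp add: Me T_coeffs var)
    show "z j \<in> coeffs_in (Sym (vspan N))" for j
      unfolding z_def by (intro B.diff_A B.mult_A W x)
    show "(\<Sum>j<n + 2. M $$ (i, j) * z j) \<in> coeffs_in Q" if i: "i < n + 2" for i
    proof -
      let ?E = "\<lambda>r. sg 0 (sym_var (s + r)) :: 'k point_sym"
      let ?Te = "\<lambda>r. T (sym_var (s + r))"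
      have "(\<Sum>j<n + 2. M $$ (i, j) * z j) = (\<Sum>j\<le>Suc n.
          ?Te (int i + int j) * ?W (s + int j - 1) - ?x * ?Te (int i + int j) * ?W (s + int j))"
        using i by (intro sum.cong) (auto simp: Me z_def right_diff_distrib add.assoc mult_ac)
      also have "\<dots> = (\<Sum>j\<le>Suc n. ?Te (int i + int j) * ?W (s + int j - 1)) -
          (\<Sum>j\<le>Suc n. ?x * ?Te (int i + int j) * ?W (s + int j))"
        by (rule sum_subtractf)
      also have "(\<Sum>j\<le>Suc n. ?Te (int i + int j) * ?W (s + int j - 1)) =
          (\<Sum>j\<le>n. ?Te (int i + int j + 1) * ?W (s + int j))"
        by (subst sum.atMost_Suc_shift) (use ends(1) in \<open>simp add: add_ac\<close>)
      also have "(\<Sum>j\<le>Suc n. ?x * ?Te (int i + int j) * ?W (s + int j)) =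
          (\<Sum>j\<le>n. ?x * ?Te (int i + int j) * ?W (s + int j))"
        using ends(2) by (simp add: add_ac)
      also have "(\<Sum>j\<le>n. ?Te (int i + int j + 1) * ?W (s + int j)) - \<dots> =
          (\<Sum>j\<le>n. (?Te (int i + int j + 1) - ?x * ?Te (int i + int j)) * ?W (s + int j))"
        by (simp add: sum_subtractf left_diff_distrib)
      \<comment> \<open>The added point cancels, since $x^{r+1} = x\cdot x^r$.\<close>
      also have "\<dots> = (\<Sum>j\<le>n. (?E (int i + int j + 1) - ?x * ?E (int i + int j)) * ?W (s + int j))"
      proof -
        have "?Te (r + 1) - ?x * ?Te r = ?E (r + 1) - ?x * ?E r" for r
          by (simp add: T_var distrib_left mult_single xy_simps add_ac)
        then show ?thesis by (simp only:)
      qed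
      also have "\<dots> = (\<Sum>j\<le>n. ?E (int (Suc i) + int j) * ?W (s + int j)) -
          ?x * (\<Sum>j\<le>n. ?E (int i + int j) * ?W (s + int j))"
        by (simp add: left_diff_distrib sum_subtractf sum_distrib_left mult.assoc add_ac)
      also have "\<dots> \<in> coeffs_in Q"
      proof -
        have "sg 0 (sum f X) = (\<Sum>x\<in>X. sg 0 (f x) :: 'k point_sym)" for f and X :: "nat set"
          by (induction X rule: infinite_finite_induct) (simp_all add: single_add)
        then have "(\<Sum>j\<le>n. ?E (int i + int j) * ?W (s + int j)) =
            sg 0 (\<Sum>j\<le>n. sym_var (s + int i + int j) * lk w (s + int j))" for i
          by (simp add: mult_single add.assoc)
        then have "(\<Sum>j\<le>n. ?E (int i + int j) * ?W (s + int j)) \<in> coeffs_in Q" for i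
          by (simp only: single_coeffs_in(2)[OF rec'])
        then show ?thesis by (intro B.diff_Q B.mult_Q x)
      qed
      finally show ?thesis .
    qed
    show "nat (k - s + 1) < n + 2" using range[OF k] by auto
    \<comment> \<open>At $x^0$ this entry has the coefficient of \<open>w\<close> that is not in \<open>Q\<close>.\<close>
    have "lk (z (nat (k - s + 1))) 0 = lk w k"
    proof -
      have "xy 1 0 \<noteq> 0" using xy_eq_iff[of 1 0 0 0] by (simp add: xy_simps)
      then show ?thesis
        using range[OF k] by (simp add: z_def lookup_minus mult_single lookup_single when_def)
    qed
    then show "z (nat (k - s + 1)) \<notin> coeffs_in Q"
      using w(3) by (auto dest: coeffs_inD[of _ _ 0])
  qed
  moreover have "det M = T (det H)" by (simp add: M_def)
  moreover have "det H \<in> Sym (vspan N)"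
    by (rule det_A[OF H]) (simp add: He var)
  ultimately have "det H \<in> point_prime" by (simp add: point_prime_def)
  moreover have "det H \<noteq> 0" unfolding H_def by (rule det_hankel_nonzero)
  ultimately show ?thesis by blast
qed

end

section \<open>Descending chains\<close>

lemma witt_prime_iff:
  "exponent_set N \<Longrightarrow> prime_poisson_ideal (vspan N) Q \<longleftrightarrow> witt_prime N Q"
  by (auto simp: prime_poisson_ideal_iff witt_prime_def)

lemma ex_smaller_prime_poisson_ideal:
  fixes Q :: "'k::field_char_0 sym set"
  assumes N: "exponent_set N" and Q: "prime_poisson_ideal (vspan N) Q" "Q \<noteq> {0}"
  obtains P where "prime_poisson_ideal (vspan N) P" "P \<noteq> {0}" "P \<subset> Q"
proof -
  obtain T :: "'k sym \<Rightarrow> 'k point_sym" where T: "point_substitution T"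
    using ex_point_substitution by blast
  interpret witt_prime_substitution N Q T
    using Q(1) T N by (simp add: witt_prime_substitution_def witt_prime_iff)
  show ?thesis
    using that[of point_prime] point_prime_witt_prime point_prime_nonzero point_prime_strict Q(2) N
    by (simp add: witt_prime_iff)
qed

lemma poisson_height_infinite:
  fixes Q :: "'k::field_char_0 sym set"
  assumes N: "exponent_set N" and Q: "prime_poisson_ideal (vspan N) Q" "Q \<noteq> {0}"
  shows "poisson_height (vspan N) Q = \<infinity>"
proof -
  have chain: "\<exists>c. (\<forall>i\<le>n. prime_poisson_ideal (vspan N) (c i)) \<and> (\<forall>i<n. c i \<subset> c (Suc i)) \<and> c n = Q"
    for n using Q
  proof (induction n arbitrary: Q)
    case 0
    then show ?case by (intro exI[of _ "\<lambda>_. Q"]) auto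
  next
    case (Suc n)
    obtain P where P: "prime_poisson_ideal (vspan N) P" "P \<noteq> {0}" "P \<subset> Q"
      using ex_smaller_prime_poisson_ideal[OF N Suc.prems] .
    obtain c where c: "\<forall>i\<le>n. prime_poisson_ideal (vspan N) (c i)" "\<forall>i<n. c i \<subset> c (Suc i)" "c n = P"
      using Suc.IH[OF P(1,2)] by blast
    show ?case
      by (rule exI[of _ "c(Suc n := Q)"]) (use c P Suc.prems in \<open>auto simp: le_Suc_eq less_Suc_eq\<close>)
  qed
  have "enat n \<le> poisson_height (vspan N) Q" for n
    unfolding poisson_height_def by (rule Sup_upper) (use chain[of n] in auto)
  then show ?thesis by (cases "poisson_height (vspan N) Q") (metis Suc_n_not_le_n enat_ord_simps(1))+
qed

theorem corollary5p4p2: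
  fixes g :: "'k::{alg_closed_field, field_char_0} laurent set"
  assumes "uncountable (UNIV :: 'k set)"
    and "g = Witt \<or> g = Witt_ge_m1 \<or> g = Witt_ge_1"
  shows "\<not> (\<exists>Q. prime_poisson_ideal g Q \<and> Q \<noteq> {0} \<and> poisson_height g Q < \<infinity>)"
proof -
  have "\<exists>N. g = vspan N \<and> exponent_set N"
    using assms(2) by (auto simp: exponent_set_def Witt_def Witt_ge_m1_def Witt_ge_1_def)
  then obtain N where N: "g = vspan N" "exponent_set N" by blast
  show ?thesis
    unfolding N(1) using poisson_height_infinite[OF N(2)] by (metis order_less_irrefl)
qed

end
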